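(* Let $R=K[[\mathbf x,z]]$ with $\mathbf x=(x_1,\dots,x_n)$, let $J\subseteq R$ be an ideal of order $c=\mathrm{ord}\,J$, and let $J_{-1}=\mathrm{coeff}^c_{(\mathbf x,z)}(J)$. Let $\omega:K[[\mathbf x]]\to\mathbb N_\infty^l$ be a weighted order function defined on the parameters $\mathbf x$ with $\omega(J_{-1})>0$. Let $z=\tilde z+g$ be a change of coordinates with $g\in K[[\mathbf x]]$, $\mathrm{ord}\,g\ge1$, and let $\tilde J_{-1}=\mathrm{coeff}^c_{(\mathbf x,\tilde z)}(J)$. If there is an element $f\in J$ that is $\omega$-clean with respect to $J_{-1}$, then $\omega(\tilde J_{-1})\le\omega(J_{-1})$.
   Context: $K$ is an algebraically closed field of arbitrary characteristic, $c$ is a positive integer, $\mathbb N_\infty=\mathbb N\cup\{\infty\}$, and $\mathbb N_\infty^l$ is ordered lexicographically. Order: in a local ring, $\mathrm{ord}\,J=\sup\{n:J\subseteq\mathfrak m^n\}$, with $\mathfrak m$ the maximal ideal. Coefficient ideal: writing each $f\in J$ as $f=\sum_{i\ge0}f_iz^i$ with $f_i\in K[[\mathbf x]]$, $\mathrm{coeff}^c_{(\mathbf x,z)}(J)$ is the ideal $(f_i^{c!/(c-i)}:f\in J,\ 0\le i<c)$ of $R/(z)\cong K[[\mathbf x]]$. Weighted order function defined on $\mathbf x$: given by weights $\omega(x_1),\dots,\omega(x_n)\in\mathbb N^l$ via $\omega(\sum c_\alpha\mathbf x^\alpha)=\min\{\sum_i\alpha_i\omega(x_i):c_\alpha\ne0\}$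 and $\omega(0)=(\infty,\dots,\infty)$; for an ideal $\omega(J)=\min_{f\in J}\omega(f)$. The initial form $\mathrm{in}_\omega(f)$ of $f=\sum c_\alpha\mathbf x^\alpha\neq0$ is $\sum_{\omega(\mathbf x^\alpha)=\omega(f)}c_\alpha\mathbf x^\alpha$; $\mathrm{in}_\omega(0)=0$. $f\in R$ is $z$-regular of order $c$ if $f(0,\dots,0,z)=z^cu(z)$ for a unit $u\in K[[z]]^*$. Put $q=1$ if $\mathrm{char}K=0$ and $q=p^{\mathrm{ord}_pc}$ (the largest power of $p$ dividing $c$) if $\mathrm{char}K=p>0$. Let $m=\omega(J_{-1})$. An element $f=\sum f_iz^i\in J$ that is $z$-regular of order $c$ is called $\omega$-clean with respect to $J_{-1}$ if at least one of the following holds: (1) there is an index $i$ with $c-q<i<c$ and $\omega(f_i)=\frac{c-i}{c!}m$; (2) $\omega(f_{c-q})>\frac q{c!}m$; (3) there is no $G\in K[[\mathbf x]]$ with $\mathrm{in}_\omega(f_{c-q})=\mathrm{in}_\omega(f_c)\cdot G^q$. *)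

theory Defs
  imports
    "HOL-Computational_Algebra.Computational_Algebra"
    "HOL-Library.Poly_Mapping"
    "HOL-Library.List_Lexorder"
    "HOL-Library.Extended_Real"
begin

section \<open>Power series in several variables\<close>

text \<open>
  The ring \<open>K[[x\<^sub>1, \<dots>, x\<^sub>n]]\<close>: the variables are indexed by the finite type \<^typ>\<open>'n\<close>, and a
  monomial \<open>x\<^sup>\<alpha>\<close> is given by its exponent vector \<open>\<alpha>\<close>.
\<close>

typedef ('k, 'n) mpowser = "UNIV :: (('n \<Rightarrow>\<^sub>0 nat) \<Rightarrow> 'k) set"
  morphisms mcoeff Abs_mpowser
  by simp

lemma mcoeff_Abs_mpowser [simp]: "mcoeff (Abs_mpowser c) = c"
  by (simp add: Abs_mpowser_inverse)

lemma mpowser_eq_iff: "f = g \<longleftrightarrow> (\<forall>\<gamma>. mcoeff f \<gamma> = mcoeff g \<gamma>)"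
  by (metis ext mcoeff_inject)

lemma finite_exponent_splits [simp]:
  fixes \<gamma> :: "'n::finite \<Rightarrow>\<^sub>0 nat"
  shows "finite {(\<alpha>, \<beta>). \<alpha> + \<beta> = \<gamma>}"
proof -
  let ?h = "\<lambda>(\<alpha>, \<beta>). (Poly_Mapping.lookup \<alpha>, Poly_Mapping.lookup \<beta>) :: ('n \<Rightarrow> nat) \<times> ('n \<Rightarrow> nat)"
  let ?P = "PiE UNIV (\<lambda>i. {..Poly_Mapping.lookup \<gamma> i})"
  have "?h ` {(\<alpha>, \<beta>). \<alpha> + \<beta> = \<gamma>} \<subseteq> ?P \<times> ?P"
    by (auto simp: Poly_Mapping.lookup_add PiE_UNIV_domain)
  moreover have "finite (?P \<times> ?P)"
    by (intro finite_cartesian_product finite_PiE) auto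
  moreover have "inj_on ?h {(\<alpha>, \<beta>). \<alpha> + \<beta> = \<gamma>}"
    by (auto simp: inj_on_def Poly_Mapping.lookup_inject)
  ultimately show ?thesis
    by (meson finite_imageD finite_subset)
qed

instantiation mpowser :: (comm_ring_1, finite) comm_ring_1
begin

definition "0 = Abs_mpowser (\<lambda>_. 0)"
definition "1 = Abs_mpowser (\<lambda>\<gamma>. if \<gamma> = 0 then 1 else 0)"
definition "f + g = Abs_mpowser (\<lambda>\<gamma>. mcoeff f \<gamma> + mcoeff g \<gamma>)"
definition "f - g = Abs_mpowser (\<lambda>\<gamma>. mcoeff f \<gamma> - mcoeff g \<gamma>)"
definition "- f = Abs_mpowser (\<lambda>\<gamma>. - mcoeff f \<gamma>)"
definition "f * g =
  Abs_mpowser (\<lambda>\<gamma>. \<Sum>(\<alpha>, \<beta>) \<in> {(\<alpha>, \<beta>). \<alpha> + \<beta> = \<gamma>}. mcoeff f \<alpha> * mcoeff g \<beta>)"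

lemma mcoeff_0 [simp]: "mcoeff 0 \<gamma> = 0"
  and mcoeff_1: "mcoeff 1 \<gamma> = (if \<gamma> = 0 then 1 else 0)"
  and mcoeff_add [simp]: "mcoeff (f + g) \<gamma> = mcoeff f \<gamma> + mcoeff g \<gamma>"
  and mcoeff_diff [simp]: "mcoeff (f - g) \<gamma> = mcoeff f \<gamma> - mcoeff g \<gamma>"
  and mcoeff_uminus [simp]: "mcoeff (- f) \<gamma> = - mcoeff f \<gamma>"
  and mcoeff_mult:
    "mcoeff (f * g) \<gamma> = (\<Sum>(\<alpha>, \<beta>) \<in> {(\<alpha>, \<beta>). \<alpha> + \<beta> = \<gamma>}. mcoeff f \<alpha> * mcoeff g \<beta>)"
  for f g :: "('a, 'b) mpowser"
  by (simp_all add: zero_mpowser_def one_mpowser_def plus_mpowser_def minus_mpowser_def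
      uminus_mpowser_def times_mpowser_def)

instance
proof
  fix f g h :: "('a, 'b) mpowser"
  show "f * g * h = f * (g * h)"
  proof -
    have "mcoeff (f * g * h) \<gamma> = mcoeff (f * (g * h)) \<gamma>" for \<gamma>
    proof -
      have "mcoeff (f * g * h) \<gamma> =
        (\<Sum>(x, y) \<in> (SIGMA x:{(\<delta>, \<epsilon>). \<delta> + \<epsilon> = \<gamma>}. {(\<alpha>, \<beta>). \<alpha> + \<beta> = fst x}).
          mcoeff f (fst y) * mcoeff g (snd y) * mcoeff h (snd x))"
        by (simp add: mcoeff_mult case_prod_beta sum_distrib_right sum.Sigma)
      also have "\<dots> =
        (\<Sum>(x, y) \<in> (SIGMA x:{(\<delta>, \<epsilon>). \<delta> + \<epsilon> = \<gamma>}. {(\<alpha>, \<beta>). \<alpha> + \<beta> = snd x}).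
          mcoeff f (fst x) * (mcoeff g (fst y) * mcoeff h (snd y)))"
        by (rule sum.reindex_bij_witness
            [where i = "\<lambda>((a, _), (b, c)). ((a + b, c), (a, b))"
               and j = "\<lambda>((_, c), (a, b)). ((a, b + c), (b, c))"])
          (auto simp: ac_simps)
      also have "\<dots> = mcoeff (f * (g * h)) \<gamma>"
        by (simp add: mcoeff_mult case_prod_beta sum_distrib_left sum.Sigma)
      finally show ?thesis .
    qed
    then show ?thesis
      by (simp add: mpowser_eq_iff)
  qed
  show "f * g = g * f"
  proof -
    have "mcoeff (f * g) \<gamma> = mcoeff (g * f) \<gamma>" for \<gamma>
      unfolding mcoeff_mult
      by (rule sum.reindex_bij_witness
          [where i = "\<lambda>(a, b). (b, a)" and j = "\<lambda>(a, b). (b, a)"]) (auto simp: ac_simps)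
    then show ?thesis
      by (simp add: mpowser_eq_iff)
  qed
  show "1 * f = f"
  proof -
    have "mcoeff (1 * f) \<gamma> = mcoeff f \<gamma>" for \<gamma>
    proof -
      have "mcoeff (1 * f) \<gamma> =
        (\<Sum>(\<alpha>, \<beta>) \<in> {(0, \<gamma>)}. mcoeff 1 \<alpha> * mcoeff f \<beta>)"
        unfolding mcoeff_mult
        by (rule sum.mono_neutral_right) (auto simp: mcoeff_1 split: if_splits)
      then show ?thesis
        by (simp add: mcoeff_1)
    qed
    then show ?thesis
      by (simp add: mpowser_eq_iff)
  qed
  show "(f + g) * h = f * h + g * h"
    by (simp add: mpowser_eq_iff mcoeff_mult case_prod_beta distrib_right sum.distrib)
  show "(0 :: ('a, 'b) mpowser) \<noteq> 1"
    by (auto simp: mpowser_eq_iff mcoeff_1)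
qed (simp_all add: mpowser_eq_iff algebra_simps)

end

text \<open>
  The ring \<open>R = K[[x, z]]\<close> is represented as \<open>K[[x]][[z]]\<close>, i.e. by the type
  \<^typ>\<open>('k, 'n) mpowser fps\<close>.  The parameter \<open>z\<close> is \<^const>\<open>fps_X\<close>, the inclusion of \<open>K[[x]]\<close> in \<open>R\<close>
  is \<^const>\<open>fps_const\<close>, and the coefficient \<open>f\<^sub>i\<close> in \<open>f = \<Sum> f\<^sub>i z\<^sup>i\<close> is \<^term>\<open>fps_nth f i\<close>.
\<close>


section \<open>Ideals and order\<close>

definition is_ideal :: "'a::comm_ring_1 set \<Rightarrow> bool" where
  "is_ideal I \<longleftrightarrow> module.subspace (*) I"

definition ideal_gen :: "'a::comm_ring_1 set \<Rightarrow> 'a set" where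
  "ideal_gen S = module.span (*) S"

primrec ideal_power :: "'a::comm_ring_1 set \<Rightarrow> nat \<Rightarrow> 'a set" where
  "ideal_power I 0 = UNIV"
| "ideal_power I (Suc n) = ideal_gen {a * b | a b. a \<in> I \<and> b \<in> ideal_power I n}"

definition is_maximal_ideal :: "'a::comm_ring_1 set \<Rightarrow> bool" where
  "is_maximal_ideal M \<longleftrightarrow> is_ideal M \<and> M \<noteq> UNIV \<and>
     (\<forall>I. is_ideal I \<and> M \<subseteq> I \<and> I \<noteq> UNIV \<longrightarrow> I = M)"

text \<open>Meaningful only for a local ring, where the maximal ideal is unique.\<close>

definition the_max_ideal :: "'a::comm_ring_1 set" where
  "the_max_ideal = (THE M. is_maximal_ideal M)"

definition ideal_ord :: "'a::comm_ring_1 set \<Rightarrow> enat" where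
  "ideal_ord J = Sup {enat n | n. J \<subseteq> ideal_power the_max_ideal n}"

definition elem_ord :: "'a::comm_ring_1 \<Rightarrow> enat" where
  "elem_ord f = ideal_ord (ideal_gen {f})"


section \<open>Coefficient ideals\<close>

text \<open>
  The expansion \<open>f = \<Sum> a\<^sub>i y\<^sup>i\<close> with \<open>a\<^sub>i \<in> K[[x]]\<close>, convergence being that of the \<open>m\<close>-adic topology
  of \<open>R\<close>.  The composition \<^const>\<open>fps_compose\<close> is of no use for a change of coordinates
  \<open>z = y + g\<close> with \<open>g \<in> K[[x]]\<close>: it yields the right result only if the inner series has constant
  coefficient \<open>0\<close> with respect to \<open>z\<close>.
\<close>

definition expands_in ::
  "('k::field, 'n::finite) mpowser fps \<Rightarrow> ('k, 'n) mpowser fps \<Rightarrow>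
    (nat \<Rightarrow> ('k, 'n) mpowser) \<Rightarrow> bool" where
  "expands_in y f a \<longleftrightarrow>
     (\<forall>k. \<forall>\<^sub>F N in sequentially.
        f - (\<Sum>i<N. fps_const (a i) * y ^ i) \<in> ideal_power the_max_ideal k)"

text \<open>The coefficient ideal of \<open>J\<close> with respect to the parameters \<open>(x, y)\<close>.\<close>

definition coeff_ideal ::
  "nat \<Rightarrow> ('k::field, 'n::finite) mpowser fps \<Rightarrow> ('k, 'n) mpowser fps set \<Rightarrow>
    ('k, 'n) mpowser set" where
  "coeff_ideal c y J =
     ideal_gen {a i ^ (fact c div (c - i)) | f a i. f \<in> J \<and> expands_in y f a \<and> i < c}"


section \<open>Weighted order functions\<close>

text \<open>
  Elements of \<open>\<nat>\<^sub>\<infinity>\<^sup>l\<close> are lists of length \<open>l\<close>; on lists of equal length the order of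
  \<^theory>\<open>HOL-Library.List_Lexorder\<close> is the usual lexicographic order.  The weights are
  \<open>w i = \<omega>(x\<^sub>i)\<close>, lists of natural numbers of length \<open>l\<close>.
\<close>

definition monom_weight ::
  "nat \<Rightarrow> ('n::finite \<Rightarrow> nat list) \<Rightarrow> ('n \<Rightarrow>\<^sub>0 nat) \<Rightarrow> enat list" where
  "monom_weight l w \<alpha> = map (\<lambda>k. enat (\<Sum>i\<in>UNIV. Poly_Mapping.lookup \<alpha> i * (w i ! k))) [0..<l]"

definition weighted_ord ::
  "nat \<Rightarrow> ('n::finite \<Rightarrow> nat list) \<Rightarrow> ('k::field, 'n) mpowser \<Rightarrow> enat list" where
  "weighted_ord l w f =
     (if f = 0 then replicate l \<infinity>
      else (LEAST v. v \<in> monom_weight l w ` {\<alpha>. mcoeff f \<alpha> \<noteq> 0}))"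

definition weighted_ord_ideal ::
  "nat \<Rightarrow> ('n::finite \<Rightarrow> nat list) \<Rightarrow> ('k::field, 'n) mpowser set \<Rightarrow> enat list" where
  "weighted_ord_ideal l w J = (LEAST v. v \<in> weighted_ord l w ` J)"

definition initial_form ::
  "nat \<Rightarrow> ('n::finite \<Rightarrow> nat list) \<Rightarrow> ('k::field, 'n) mpowser \<Rightarrow> ('k, 'n) mpowser" where
  "initial_form l w f =
     (if f = 0 then 0
      else Abs_mpowser (\<lambda>\<alpha>. if monom_weight l w \<alpha> = weighted_ord l w f then mcoeff f \<alpha> else 0))"

text \<open>
  Multiples by a rational number \<open>r > 0\<close> of vectors in \<open>\<nat>\<^sub>\<infinity>\<^sup>l\<close> are taken in the extended reals, where
  \<open>r \<cdot> \<infinity> = \<infinity>\<close>.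
\<close>

definition ext_vec :: "enat list \<Rightarrow> ereal list" where
  "ext_vec v = map ereal_of_enat v"

definition scale_vec :: "real \<Rightarrow> enat list \<Rightarrow> ereal list" where
  "scale_vec r v = map (\<lambda>a. ereal r * ereal_of_enat a) v"


section \<open>Clean elements\<close>

definition z_regular :: "nat \<Rightarrow> ('k::field, 'n::finite) mpowser fps \<Rightarrow> bool" where
  "z_regular c f \<longleftrightarrow>
     (\<exists>u :: 'k fps. u dvd 1 \<and> Abs_fps (\<lambda>i. mcoeff (fps_nth f i) 0) = fps_X ^ c * u)"

definition char_part :: "'k::field itself \<Rightarrow> nat \<Rightarrow> nat" where
  "char_part _ c = (if CHAR('k) = 0 then 1 else CHAR('k) ^ multiplicity CHAR('k) c)"

text \<open>The argument \<open>I\<close> is the coefficient ideal with respect to which \<open>f\<close> is clean.\<close>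

definition omega_clean ::
  "nat \<Rightarrow> ('n::finite \<Rightarrow> nat list) \<Rightarrow> nat \<Rightarrow> ('k::field, 'n) mpowser set \<Rightarrow>
    ('k, 'n) mpowser fps \<Rightarrow> bool" where
  "omega_clean l w c I f \<longleftrightarrow>
     (let q = char_part TYPE('k) c; m = weighted_ord_ideal l w I
      in z_regular c f \<and>
         ((\<exists>i. c - q < i \<and> i < c \<and>
             ext_vec (weighted_ord l w (fps_nth f i)) = scale_vec (real (c - i) / fact c) m) \<or>
          ext_vec (weighted_ord l w (fps_nth f (c - q))) > scale_vec (real q / fact c) m \<or>
          (\<nexists>G. initial_form l w (fps_nth f (c - q)) = initial_form l w (fps_nth f c) * G ^ q)))"

end

theory Submission
  imports Defs
begin

text \<open>
  Put \<open>y = z - g\<close> and let \<open>m\<close> be the value of the coefficient ideal with respect to \<open>z\<close>.  The value of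
  the coefficient ideal exceeds \<open>m\<close> exactly when all coefficients of index \<open>i < c\<close> have value greater
  than \<open>(c - i) t\<close>, where \<open>t = m / c!\<close>.  Suppose that this holds for the coefficients \<open>a\<^sub>i\<close> of every
  element of \<open>J\<close> in the expansion with respect to \<open>y\<close>.  Substituting \<open>y = z - g\<close> in
  \<open>f = \<Sum>\<^sub>i\<^sub><\<^sub>c a\<^sub>i y\<^sup>i + y\<^sup>c H\<close> gives (\<open>coefficient_of_expansion\<close>), for \<open>k \<le> c\<close>,
  \<open>f\<^sub>k = \<Sum>\<^sub>i\<^sub><\<^sub>c binom(i, k) (-g)\<^sup>i\<^sup>-\<^sup>k a\<^sub>i + binom(c, k) (-g)\<^sup>c\<^sup>-\<^sup>k f\<^sub>c + g\<^sup>c\<^sup>-\<^sup>k\<^sup>+\<^sup>1 s\<close>,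
  and the value of \<open>g\<close> is forced to be exactly \<open>t\<close>:

  \<^item> If it were smaller, the last two terms would give the \<open>f\<^sub>0\<close> of a \<open>z\<close>-regular \<open>f\<close> the value
    \<open>c \<omega>(g) < c t\<close>, although \<open>\<omega>(f\<^sub>0) \<ge> c t\<close> by the definition of \<open>m\<close> (\<open>weight_of_shift_ge\<close>).
  \<^item> If it were larger, all coefficients of all elements of \<open>J\<close> with respect to \<open>z\<close> would have value
    greater than \<open>(c - k) t\<close>, so that \<open>m\<close> would not be attained on its own coefficient ideal.

  Hence \<open>f\<^sub>k\<close> equals \<open>binom(c, k) (-g)\<^sup>c\<^sup>-\<^sup>k f\<^sub>c\<close> up to terms of value greater than \<open>(c - k) t\<close>
  (\<open>coefficient_mod_higher_weight\<close>).  In \<open>K\<close> the binomial coefficients vanish for \<open>c - q < k < c\<close> and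
  do not vanish for \<open>k = c - q\<close> (\<open>char_part_binomial\<close>).  The first fact excludes the first way of being
  clean; the second shows that \<open>f\<^sub>c\<^sub>-\<^sub>q\<close> has value exactly \<open>q t\<close>, which excludes the second way, and that
  its initial form is \<open>in(f\<^sub>c)\<close> times a \<open>q\<close>-th power, since \<open>K\<close> contains a \<open>q\<close>-th root of the binomial
  coefficient; this excludes the third (\<open>initial_part_pure_power\<close>).

  Values are compared in the ordered ring of real polynomials rather than among lists: a vector is read
  as the coefficients of a polynomial, leading coefficient first, so that the lexicographic order becomes
  the order of polynomials, and values can be added, scaled by rational numbers and handled by the rules
  for ordered rings.
\<close>

section \<open>Weights of monomials\<close>

text \<open>
  Comparing the value of \<open>f\<close> with a bound \<open>t\<close> through the support of \<open>f\<close> makes \<open>f = 0\<close> pass every bound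
  and leaves no infinite value to be handled.
\<close>

definition weight_ge :: "(('n \<Rightarrow>\<^sub>0 nat) \<Rightarrow> 'a::linordered_idom) \<Rightarrow> 'a \<Rightarrow> ('k::zero, 'n) mpowser set" where
  "weight_ge V t = {f. \<forall>\<alpha>. mcoeff f \<alpha> \<noteq> 0 \<longrightarrow> t \<le> V \<alpha>}"

definition weight_gt :: "(('n \<Rightarrow>\<^sub>0 nat) \<Rightarrow> 'a::linordered_idom) \<Rightarrow> 'a \<Rightarrow> ('k::zero, 'n) mpowser set" where
  "weight_gt V t = {f. \<forall>\<alpha>. mcoeff f \<alpha> \<noteq> 0 \<longrightarrow> t < V \<alpha>}"

definition weight_part :: "(('n \<Rightarrow>\<^sub>0 nat) \<Rightarrow> 'a::linordered_idom) \<Rightarrow> 'a \<Rightarrow>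
    ('k::zero, 'n) mpowser \<Rightarrow> ('k, 'n) mpowser" where
  "weight_part V t f = Abs_mpowser (\<lambda>\<alpha>. if V \<alpha> = t then mcoeff f \<alpha> else 0)"

lemma mcoeff_mult_nonzeroE:
  fixes f h :: "('k::comm_ring_1, 'n::finite) mpowser"
  assumes "mcoeff (f * h) \<gamma> \<noteq> 0"
  obtains \<alpha> \<beta> where "\<alpha> + \<beta> = \<gamma>" "mcoeff f \<alpha> \<noteq> 0" "mcoeff h \<beta> \<noteq> 0"
proof -
  from assms obtain x where "x \<in> {(\<alpha>, \<beta>). \<alpha> + \<beta> = \<gamma>}"
    "(case x of (\<alpha>, \<beta>) \<Rightarrow> mcoeff f \<alpha> * mcoeff h \<beta>) \<noteq> 0"
    unfolding mcoeff_mult by (rule sum.not_neutral_contains_not_neutral)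
  moreover obtain \<alpha> \<beta> where "x = (\<alpha>, \<beta>)" by (cases x)
  ultimately have "\<alpha> + \<beta> = \<gamma>" "mcoeff f \<alpha> * mcoeff h \<beta> \<noteq> 0" by simp_all
  moreover from this have "mcoeff f \<alpha> \<noteq> 0" "mcoeff h \<beta> \<noteq> 0" by (metis mult_zero_left, metis mult_zero_right)
  ultimately show ?thesis
    using that by blast
qed

text \<open>
  If only one pair of monomials of \<open>f\<close> and \<open>h\<close> can contribute to a monomial of \<open>f h\<close>, nothing can cancel
  there.  Products of leading monomials and products with constants are of this kind.
\<close>

lemma mcoeff_mult_unique:
  fixes f h :: "('k::comm_ring_1, 'n::finite) mpowser"
  assumes "\<And>\<alpha>' \<beta>'. \<alpha>' + \<beta>' = \<alpha> + \<beta> \<Longrightarrow> mcoeff f \<alpha>' \<noteq> 0 \<Longrightarrow> mcoeff h \<beta>' \<noteq> 0 \<Longrightarrow> \<alpha>' = \<alpha>"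
  shows "mcoeff (f * h) (\<alpha> + \<beta>) = mcoeff f \<alpha> * mcoeff h \<beta>"
proof -
  have "mcoeff (f * h) (\<alpha> + \<beta>) = (\<Sum>(\<alpha>, \<beta>) \<in> {(\<alpha>, \<beta>)}. mcoeff f \<alpha> * mcoeff h \<beta>)"
    unfolding mcoeff_mult
  proof (rule sum.mono_neutral_right)
    show "\<forall>x \<in> {(\<alpha>', \<beta>'). \<alpha>' + \<beta>' = \<alpha> + \<beta>} - {(\<alpha>, \<beta>)}.
        (case x of (\<alpha>, \<beta>) \<Rightarrow> mcoeff f \<alpha> * mcoeff h \<beta>) = 0"
    proof
      fix x assume x: "x \<in> {(\<alpha>', \<beta>'). \<alpha>' + \<beta>' = \<alpha> + \<beta>} - {(\<alpha>, \<beta>)}"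
      obtain \<alpha>' \<beta>' where [simp]: "x = (\<alpha>', \<beta>')" by (cases x)
      have "\<alpha>' + \<beta>' = \<alpha> + \<beta>" "\<alpha>' \<noteq> \<alpha>" using x by auto
      with assms[of \<alpha>' \<beta>'] show "(case x of (\<alpha>, \<beta>) \<Rightarrow> mcoeff f \<alpha> * mcoeff h \<beta>) = 0"
        by (auto, metis mult_zero_left mult_zero_right)
    qed
  qed auto
  then show ?thesis by simp
qed

lemma mcoeff_sum [simp]: "mcoeff (sum F A) \<gamma> = (\<Sum>i\<in>A. mcoeff (F i) \<gamma>)"
  for F :: "'i \<Rightarrow> ('k::comm_ring_1, 'n::finite) mpowser"
  by (induction A rule: infinite_finite_induct) auto

lemma add_exponents_eq_0_iff: "\<alpha> + \<beta> = 0 \<longleftrightarrow> \<alpha> = 0 \<and> \<beta> = 0" for \<alpha> \<beta> :: "'n \<Rightarrow>\<^sub>0 nat"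
  by (auto simp: poly_mapping_eq_iff fun_eq_iff lookup_add)

lemma mcoeff_mult_0 [simp]: "mcoeff (f * h) 0 = mcoeff f 0 * mcoeff h 0"
  for f h :: "('k::comm_ring_1, 'n::finite) mpowser"
  using mcoeff_mult_unique[of 0 0 f h] by (simp add: add_exponents_eq_0_iff)

text \<open>
  The existence of minima stands in for a well-ordered value semigroup.  The total degree and the weighted
  order functions are both instances.
\<close>

locale monomial_weight =
  fixes V :: "('n::finite \<Rightarrow>\<^sub>0 nat) \<Rightarrow> 'a::linordered_idom"
  assumes weight_add: "V (\<alpha> + \<beta>) = V \<alpha> + V \<beta>"
    and weight_nonneg: "0 \<le> V \<alpha>"
    and weight_minimum: "A \<noteq> {} \<Longrightarrow> \<exists>\<alpha>\<in>A. \<forall>\<beta>\<in>A. V \<alpha> \<le> V \<beta>"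
begin

lemma weight_0: "V 0 = 0"
  using weight_add[of 0 0] by simp

lemma weight_gt_mono: "f \<in> weight_gt V t \<Longrightarrow> s \<le> t \<Longrightarrow> f \<in> weight_gt V s"
  by (force simp: weight_gt_def)

lemma weight_ge_imp_gt: "f \<in> weight_ge V t \<Longrightarrow> s < t \<Longrightarrow> f \<in> weight_gt V s"
  by (force simp: weight_ge_def weight_gt_def)

lemma weight_gt_imp_ge: "f \<in> weight_gt V t \<Longrightarrow> f \<in> weight_ge V t"
  by (force simp: weight_ge_def weight_gt_def)

lemma weight_ge_0_all: "f \<in> weight_ge V 0"
  by (simp add: weight_ge_def weight_nonneg)

context
  fixes f h :: "('k::comm_ring_1, 'n) mpowser"
begin

lemma weight_ge_mult:
  assumes "f \<in> weight_ge V s" "h \<in> weight_ge V t"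
  shows "f * h \<in> weight_ge V (s + t)"
  unfolding weight_ge_def
proof safe
  fix \<gamma> assume "mcoeff (f * h) \<gamma> \<noteq> 0"
  then obtain \<alpha> \<beta> where "\<alpha> + \<beta> = \<gamma>" "mcoeff f \<alpha> \<noteq> 0" "mcoeff h \<beta> \<noteq> 0"
    by (rule mcoeff_mult_nonzeroE)
  with assms show "s + t \<le> V \<gamma>"
    by (auto simp: weight_ge_def weight_add intro!: add_mono)
qed

lemma weight_gt_mult_ge:
  assumes "f \<in> weight_gt V s" "h \<in> weight_ge V t"
  shows "f * h \<in> weight_gt V (s + t)"
  unfolding weight_gt_def
proof safe
  fix \<gamma> assume "mcoeff (f * h) \<gamma> \<noteq> 0"
  then obtain \<alpha> \<beta> where "\<alpha> + \<beta> = \<gamma>" "mcoeff f \<alpha> \<noteq> 0" "mcoeff h \<beta> \<noteq> 0"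
    by (rule mcoeff_mult_nonzeroE)
  with assms show "s + t < V \<gamma>"
    by (auto simp: weight_ge_def weight_gt_def weight_add intro!: add_less_le_mono)
qed

lemma weight_gt_add: "f \<in> weight_gt V t \<Longrightarrow> h \<in> weight_gt V t \<Longrightarrow> f + h \<in> weight_gt V t"
  unfolding weight_gt_def by (simp, metis add.right_neutral diff_0_right)

lemma weight_ge_add: "f \<in> weight_ge V t \<Longrightarrow> h \<in> weight_ge V t \<Longrightarrow> f + h \<in> weight_ge V t"
  unfolding weight_ge_def by (simp, metis add.right_neutral)

lemma weight_gt_diff: "f \<in> weight_gt V t \<Longrightarrow> h \<in> weight_gt V t \<Longrightarrow> f - h \<in> weight_gt V t"
  unfolding weight_gt_def by (simp, metis add.right_neutral diff_0_right)

lemma weight_gt_0: "(0 :: ('k, 'n) mpowser) \<in> weight_gt V t"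
  by (simp add: weight_gt_def)

lemma weight_ge_uminus: "f \<in> weight_ge V t \<Longrightarrow> - f \<in> weight_ge V t"
  by (simp add: weight_ge_def)

lemma weight_ge_mult_right: "f \<in> weight_ge V t \<Longrightarrow> f * h \<in> weight_ge V t"
  using weight_ge_mult[of t 0] by (simp add: weight_ge_0_all)

lemma weight_gt_mult_right: "f \<in> weight_gt V t \<Longrightarrow> f * h \<in> weight_gt V t"
  using weight_gt_mult_ge[of t 0] by (simp add: weight_ge_0_all)

end

lemma weight_gt_sum:
  fixes F :: "'i \<Rightarrow> ('k::comm_ring_1, 'n) mpowser"
  shows "(\<And>i. i \<in> A \<Longrightarrow> F i \<in> weight_gt V t) \<Longrightarrow> sum F A \<in> weight_gt V t"
  by (induction A rule: infinite_finite_induct) (auto intro: weight_gt_add weight_gt_0)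

lemma weight_ge_power:
  fixes f :: "('k::comm_ring_1, 'n) mpowser"
  assumes "f \<in> weight_ge V t"
  shows "f ^ n \<in> weight_ge V (of_nat n * t)"
  by (induction n) (auto intro: weight_ge_0_all weight_ge_mult assms simp: distrib_right)

lemma weight_gt_power:
  fixes f :: "('k::comm_ring_1, 'n) mpowser"
  assumes "f \<in> weight_gt V t" "n > 0"
  shows "f ^ n \<in> weight_gt V (of_nat n * t)"
proof -
  have "f * f ^ (n - 1) \<in> weight_gt V (t + of_nat (n - 1) * t)"
    using assms weight_gt_imp_ge by (intro weight_gt_mult_ge weight_ge_power) auto
  then show ?thesis
    using assms(2) by (cases n) (auto simp: distrib_right)
qed

lemma weight_attained:
  assumes "f \<notin> weight_gt V s"
  obtains t where "t \<le> s" "f \<in> weight_ge V t" "f \<notin> weight_gt V t"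
proof -
  let ?A = "{\<alpha>. mcoeff f \<alpha> \<noteq> 0}"
  from assms obtain \<beta> where \<beta>: "\<beta> \<in> ?A" "V \<beta> \<le> s"
    by (auto simp: weight_gt_def not_less)
  then obtain \<alpha> where \<alpha>: "\<alpha> \<in> ?A" "\<forall>\<beta>\<in>?A. V \<alpha> \<le> V \<beta>"
    using weight_minimum[of ?A] by blast
  show ?thesis
    by (rule that[of "V \<alpha>"]) (use \<alpha> \<beta> in \<open>auto simp: weight_ge_def weight_gt_def intro: order_trans\<close>)
qed

lemma weight_attained_below:
  assumes "f \<notin> weight_ge V t"
  obtains s where "s < t" "f \<in> weight_ge V s" "f \<notin> weight_gt V s"
proof -
  from assms obtain \<alpha> where "mcoeff f \<alpha> \<noteq> 0" "V \<alpha> < t"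
    by (auto simp: weight_ge_def not_le)
  then have "f \<notin> weight_gt V (V \<alpha>)"
    by (auto simp: weight_gt_def)
  then show ?thesis
    using \<open>V \<alpha> < t\<close> by (auto elim: weight_attained intro: that le_less_trans)
qed

text \<open>
  Two monomials of weights at least \<open>s\<close> and \<open>t\<close> multiply to one of weight \<open>s + t\<close> only if both bounds are
  attained, so the product has no other contributions in weight \<open>s + t\<close>.
\<close>

lemma weight_part_mult:
  fixes f h :: "('k::comm_ring_1, 'n) mpowser"
  assumes "f \<in> weight_ge V s" "h \<in> weight_ge V t"
  shows "weight_part V (s + t) (f * h) = weight_part V s f * weight_part V t h"
proof -
  have "mcoeff (weight_part V (s + t) (f * h)) \<gamma> = mcoeff (weight_part V s f * weight_part V t h) \<gamma>" for \<gamma>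
  proof -
    have *: "(if V (\<alpha> + \<beta>) = s + t then mcoeff f \<alpha> * mcoeff h \<beta> else 0) =
      (if V \<alpha> = s then mcoeff f \<alpha> else 0) * (if V \<beta> = t then mcoeff h \<beta> else 0)" for \<alpha> \<beta>
    proof (cases "mcoeff f \<alpha> = 0 \<or> mcoeff h \<beta> = 0")
      case False
      then have "s \<le> V \<alpha>" "t \<le> V \<beta>"
        using assms by (auto simp: weight_ge_def)
      then have "V (\<alpha> + \<beta>) = s + t \<longleftrightarrow> V \<alpha> = s \<and> V \<beta> = t"
        unfolding weight_add by linarith
      then show ?thesis by simp
    qed auto
    have "mcoeff (weight_part V (s + t) (f * h)) \<gamma> = (if V \<gamma> = s + t then mcoeff (f * h) \<gamma> else 0)"
      by (simp add: weight_part_def)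
    also have "\<dots> = (\<Sum>(\<alpha>, \<beta>) \<in> {(\<alpha>, \<beta>). \<alpha> + \<beta> = \<gamma>}. if V (\<alpha> + \<beta>) = s + t then mcoeff f \<alpha> * mcoeff h \<beta> else 0)"
    proof (cases "V \<gamma> = s + t")
      case True
      then show ?thesis by (auto simp: mcoeff_mult intro!: sum.cong)
    next
      case False
      then show ?thesis by (auto intro!: sum.neutral)
    qed
    finally show ?thesis
      by (simp add: * mcoeff_mult weight_part_def)
  qed
  then show ?thesis
    by (simp add: mpowser_eq_iff)
qed

lemma weight_part_power:
  fixes f :: "('k::comm_ring_1, 'n) mpowser"
  assumes "f \<in> weight_ge V t"
  shows "weight_part V (of_nat n * t) (f ^ n) = weight_part V t f ^ n"
proof (induction n)
  case 0
  show ?case by (simp add: weight_part_def mpowser_eq_iff mcoeff_1 weight_0)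
next
  case (Suc n)
  then show ?case
    using weight_part_mult[OF assms weight_ge_power[OF assms, of n]] by (simp add: distrib_right)
qed

end

section \<open>Lexicographic weights\<close>

definition weight_entry :: "('n::finite \<Rightarrow> nat list) \<Rightarrow> nat \<Rightarrow> ('n \<Rightarrow>\<^sub>0 nat) \<Rightarrow> nat" where
  "weight_entry w k \<alpha> = (\<Sum>i\<in>UNIV. Poly_Mapping.lookup \<alpha> i * (w i ! k))"

text \<open>
  The weight vector of a monomial as a polynomial in an infinitely large variable; its first entry is the
  most significant one and becomes the coefficient of highest degree.
\<close>

definition poly_weight :: "nat \<Rightarrow> ('n::finite \<Rightarrow> nat list) \<Rightarrow> ('n \<Rightarrow>\<^sub>0 nat) \<Rightarrow> real poly" where
  "poly_weight l w \<alpha> = (\<Sum>k<l. monom (real (weight_entry w k \<alpha>)) (l - Suc k))"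

lemma monom_weight_eq: "monom_weight l w \<alpha> = map (\<lambda>k. enat (weight_entry w k \<alpha>)) [0..<l]"
  by (simp add: monom_weight_def weight_entry_def)

lemma coeff_poly_weight:
  "coeff (poly_weight l w \<alpha>) j = (if j < l then real (weight_entry w (l - Suc j) \<alpha>) else 0)"
proof -
  have "coeff (poly_weight l w \<alpha>) j =
      (\<Sum>k<l. if l - Suc k = j then real (weight_entry w k \<alpha>) else 0)"
    by (simp add: poly_weight_def coeff_sum)
  also have "\<dots> = (\<Sum>k<l. if k = l - Suc j \<and> j < l then real (weight_entry w k \<alpha>) else 0)"
    by (intro sum.cong) auto
  also have "\<dots> = (if j < l then real (weight_entry w (l - Suc j) \<alpha>) else 0)"
    by (cases "j < l") auto
  finally show ?thesis .
qed

lemma smult_poly_weight_eq_iff: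
  "smult a (poly_weight l w \<alpha>) = smult b (poly_weight l w \<beta>) \<longleftrightarrow>
    (\<forall>k<l. a * real (weight_entry w k \<alpha>) = b * real (weight_entry w k \<beta>))"
proof
  assume *: "smult a (poly_weight l w \<alpha>) = smult b (poly_weight l w \<beta>)"
  show "\<forall>k<l. a * real (weight_entry w k \<alpha>) = b * real (weight_entry w k \<beta>)"
  proof (intro allI impI)
    fix k assume "k < l"
    then show "a * real (weight_entry w k \<alpha>) = b * real (weight_entry w k \<beta>)"
      using arg_cong[OF *, of "\<lambda>p. coeff p (l - Suc k)"] by (simp add: coeff_poly_weight)
  qed
qed (auto simp: poly_eq_iff coeff_poly_weight)

lemma poly_weight_eq_iff: "poly_weight l w \<alpha> = poly_weight l w \<beta> \<longleftrightarrow> monom_weight l w \<alpha> = monom_weight l w \<beta>"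
  using smult_poly_weight_eq_iff[of 1 l w \<alpha> 1 \<beta>] by (auto simp: monom_weight_eq)

lemma poly_less_if_first_coeff_less:
  fixes p q :: "'a::linordered_idom poly"
  assumes "coeff p j < coeff q j" "\<And>i. i > j \<Longrightarrow> coeff p i = coeff q i"
  shows "p < q"
proof -
  have "degree (q - p) = j"
  proof (rule antisym)
    show "degree (q - p) \<le> j"
      by (rule degree_le) (use assms(2) in auto)
    show "j \<le> degree (q - p)"
      by (rule le_degree) (use assms(1) in auto)
  qed
  then show ?thesis
    using assms(1) by (simp add: less_poly_def pos_poly_def)
qed

lemma poly_weight_less_iff: "poly_weight l w \<alpha> < poly_weight l w \<beta> \<longleftrightarrow> monom_weight l w \<alpha> < monom_weight l w \<beta>"
proof -
  have *: "poly_weight l w \<alpha> < poly_weight l w \<beta>" if "monom_weight l w \<alpha> < monom_weight l w \<beta>" for \<alpha> \<beta>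
  proof -
    from that obtain k where k: "k < l" "take k (monom_weight l w \<alpha>) = take k (monom_weight l w \<beta>)"
      "monom_weight l w \<alpha> ! k < monom_weight l w \<beta> ! k"
      by (auto simp: list_less_def lexord_take_index_conv monom_weight_eq)
    have "weight_entry w i \<alpha> = weight_entry w i \<beta>" if "i < k" for i
      using arg_cong[OF k(2), of "\<lambda>xs. xs ! i"] that k(1) by (simp add: monom_weight_eq)
    with k(1,3) show ?thesis
      by (intro poly_less_if_first_coeff_less[of _ "l - Suc k"])
         (auto simp: coeff_poly_weight monom_weight_eq)
  qed
  show ?thesis
    using *[of \<alpha> \<beta>] *[of \<beta> \<alpha>] poly_weight_eq_iff[of l w \<alpha> \<beta>]
    by (metis linorder_less_linear order_less_asym)
qed

lemma poly_weight_le_iff: "poly_weight l w \<alpha> \<le> poly_weight l w \<beta> \<longleftrightarrow> monom_weight l w \<alpha> \<le> monom_weight l w \<beta>"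
  using poly_weight_less_iff[of l w \<beta> \<alpha>] by (simp add: linorder_not_less[symmetric])

text \<open>
  The lexicographic order is not well-founded on all lists (\<open>[1] > [0, 1] > [0, 0, 1] > \<dots>\<close>); it is on
  lists of a common length.
\<close>

lemma lists_least:
  fixes S :: "enat list set"
  assumes "S \<noteq> {}" "\<And>v. v \<in> S \<Longrightarrow> length v = l"
  obtains v where "v \<in> S" "\<forall>u\<in>S. v \<le> u"
proof -
  have "wf (lex {(u, v::enat). u < v})"
    by (intro wf_lex wellorder_class.wf)
  then obtain v where v: "v \<in> S" "\<And>u. (u, v) \<in> lex {(u, v::enat). u < v} \<Longrightarrow> u \<notin> S"
    using assms(1) by (meson wfE_min' )
  have "v \<le> u" if "u \<in> S" for u
  proof (rule ccontr)
    assume "\<not> v \<le> u"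
    then have "(u, v) \<in> lex {(u, v::enat). u < v}"
      using assms(2) that v(1) by (simp add: lexord_lex list_less_def[symmetric])
    with v(2) that show False by blast
  qed
  with v(1) that show ?thesis by blast
qed

lemma Least_list:
  fixes S :: "enat list set"
  assumes "S \<noteq> {}" "\<And>v. v \<in> S \<Longrightarrow> length v = l"
  shows "(LEAST v. v \<in> S) \<in> S" and "\<And>u. u \<in> S \<Longrightarrow> (LEAST v. v \<in> S) \<le> u"
proof -
  obtain v where v: "v \<in> S" "\<forall>u\<in>S. v \<le> u"
    using lists_least[OF assms] by blast
  then have "(LEAST v. v \<in> S) = v"
    by (intro Least_equality) auto
  with v show "(LEAST v. v \<in> S) \<in> S" "\<And>u. u \<in> S \<Longrightarrow> (LEAST v. v \<in> S) \<le> u"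
    by auto
qed

lemma length_monom_weight [simp]: "length (monom_weight l w \<alpha>) = l"
  by (simp add: monom_weight_def)

interpretation poly_weight: monomial_weight "poly_weight l w"
proof
  show "poly_weight l w (\<alpha> + \<beta>) = poly_weight l w \<alpha> + poly_weight l w \<beta>" for \<alpha> \<beta>
    by (simp add: poly_eq_iff coeff_poly_weight weight_entry_def lookup_add distrib_right sum.distrib)
  show "\<exists>\<alpha>\<in>A. \<forall>\<beta>\<in>A. poly_weight l w \<alpha> \<le> poly_weight l w \<beta>" if "A \<noteq> {}" for A
  proof -
    have "monom_weight l w ` A \<noteq> {}" and "\<And>v. v \<in> monom_weight l w ` A \<Longrightarrow> length v = l"
      using that by auto
    then obtain v where v: "v \<in> monom_weight l w ` A" "\<forall>u\<in>monom_weight l w ` A. v \<le> u"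
      by (rule lists_least)
    then obtain \<alpha> where "\<alpha> \<in> A" "v = monom_weight l w \<alpha>" by blast
    with v(2) show ?thesis by (auto simp: poly_weight_le_iff)
  qed
  have "monom_weight l w 0 \<le> monom_weight l w \<alpha>" for \<alpha>
  proof (rule ccontr)
    assume "\<not> monom_weight l w 0 \<le> monom_weight l w \<alpha>"
    then show False
      by (auto simp: not_le list_less_def lexord_take_index_conv monom_weight_eq weight_entry_def)
  qed
  moreover have "poly_weight l w 0 = 0"
    by (simp add: poly_eq_iff coeff_poly_weight weight_entry_def)
  ultimately show "0 \<le> poly_weight l w \<alpha>" for \<alpha>
    by (metis poly_weight_le_iff)
qed

text \<open>
  The exponent vectors themselves, ordered lexicographically along an enumeration of the variables, serve
  as a monomial order that breaks ties between monomials of equal weight.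
\<close>

lemma ex_injective_weight:
  obtains U :: "('n::finite \<Rightarrow>\<^sub>0 nat) \<Rightarrow> real poly" where "monomial_weight U" "inj U"
proof -
  obtain xs :: "'n list" where xs: "set xs = UNIV"
    using finite_list[of "UNIV :: 'n set"] by auto
  define w where "w i = map (\<lambda>k. if xs ! k = i then 1 else 0 :: nat) [0..<length xs]" for i
  have entry: "weight_entry w k \<alpha> = Poly_Mapping.lookup \<alpha> (xs ! k)" if "k < length xs" for k \<alpha>
    using that by (simp add: weight_entry_def w_def if_distrib cong: if_cong)
  have "inj (poly_weight (length xs) w)"
  proof (rule injI)
    fix \<alpha> \<beta> assume "poly_weight (length xs) w \<alpha> = poly_weight (length xs) w \<beta>"
    then have *: "Poly_Mapping.lookup \<alpha> (xs ! k) = Poly_Mapping.lookup \<beta> (xs ! k)" if "k < length xs" for k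
      using that smult_poly_weight_eq_iff[of 1 "length xs" w \<alpha> 1 \<beta>] entry by simp
    show "\<alpha> = \<beta>"
    proof (rule poly_mapping_eqI)
      fix i
      obtain k where "k < length xs" "xs ! k = i"
        using xs by (metis UNIV_I in_set_conv_nth)
      with * show "Poly_Mapping.lookup \<alpha> i = Poly_Mapping.lookup \<beta> i" by auto
    qed
  qed
  with that poly_weight.monomial_weight_axioms show ?thesis by blast
qed

context monomial_weight
begin

text \<open>
  Values of products are not larger than expected.  Among the possibly infinitely many monomials of
  minimal weight in \<open>f\<close> and in \<open>h\<close>, choose those that are minimal for an injective weight \<open>U\<close>; their product
  arises in only one way, so its coefficient is a product of two nonzero elements of the field.
\<close>

lemma weight_mult_not_gt:
  fixes f h :: "('k::field, 'n) mpowser"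
  assumes f: "f \<in> weight_ge V s" "f \<notin> weight_gt V s"
    and h: "h \<in> weight_ge V t" "h \<notin> weight_gt V t"
  shows "f * h \<notin> weight_gt V (s + t)"
proof -
  obtain U :: "('n \<Rightarrow>\<^sub>0 nat) \<Rightarrow> real poly" where U: "monomial_weight U" "inj U"
    by (rule ex_injective_weight)
  interpret U: monomial_weight U by fact
  define F where "F = {\<alpha>. mcoeff f \<alpha> \<noteq> 0 \<and> V \<alpha> = s}"
  define H where "H = {\<alpha>. mcoeff h \<alpha> \<noteq> 0 \<and> V \<alpha> = t}"
  have "F \<noteq> {}" "H \<noteq> {}"
    using f h by (force simp: F_def H_def weight_ge_def weight_gt_def)+
  then obtain \<alpha> \<beta> where \<alpha>: "\<alpha> \<in> F" "\<And>\<alpha>'. \<alpha>' \<in> F \<Longrightarrow> U \<alpha> \<le> U \<alpha>'"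
    and \<beta>: "\<beta> \<in> H" "\<And>\<beta>'. \<beta>' \<in> H \<Longrightarrow> U \<beta> \<le> U \<beta>'"
    using U.weight_minimum[of F] U.weight_minimum[of H] by metis
  have "mcoeff (f * h) (\<alpha> + \<beta>) = mcoeff f \<alpha> * mcoeff h \<beta>"
  proof (rule mcoeff_mult_unique)
    fix \<alpha>' \<beta>'
    assume *: "\<alpha>' + \<beta>' = \<alpha> + \<beta>" "mcoeff f \<alpha>' \<noteq> 0" "mcoeff h \<beta>' \<noteq> 0"
    have "s \<le> V \<alpha>'" "t \<le> V \<beta>'"
      using f(1) h(1) * by (auto simp: weight_ge_def)
    moreover have "V \<alpha>' + V \<beta>' = s + t"
      using * \<alpha>(1) \<beta>(1) by (metis (mono_tags, lifting) F_def H_def mem_Collect_eq weight_add)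
    ultimately have "V \<alpha>' = s" "V \<beta>' = t" by linarith+
    then have "U \<alpha> \<le> U \<alpha>'" "U \<beta> \<le> U \<beta>'"
      using \<alpha> \<beta> * by (auto simp: F_def H_def)
    moreover have "U \<alpha>' + U \<beta>' = U \<alpha> + U \<beta>"
      using * by (metis U.weight_add)
    ultimately have "U \<alpha>' = U \<alpha>" by linarith
    then show "\<alpha>' = \<alpha>" using U(2) by (simp add: inj_eq)
  qed
  moreover have "V (\<alpha> + \<beta>) = s + t"
    using \<alpha>(1) \<beta>(1) by (simp add: weight_add F_def H_def)
  ultimately show ?thesis
    using \<alpha>(1) \<beta>(1) by (auto simp: weight_gt_def F_def H_def intro!: exI[of _ "\<alpha> + \<beta>"])
qed

lemma weight_power_not_gt:
  fixes f :: "('k::field, 'n) mpowser"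
  assumes "f \<in> weight_ge V t" "f \<notin> weight_gt V t"
  shows "f ^ n \<notin> weight_gt V (of_nat n * t)"
proof (induction n)
  case 0
  show ?case by (auto simp: weight_gt_def mcoeff_1 weight_0)
next
  case (Suc n)
  then show ?case
    using weight_mult_not_gt[OF assms weight_ge_power[OF assms(1), of n]] by (simp add: distrib_right)
qed

lemma weight_gt_power_iff:
  fixes f :: "('k::field, 'n) mpowser"
  assumes "n > 0"
  shows "f ^ n \<in> weight_gt V (of_nat n * t) \<longleftrightarrow> f \<in> weight_gt V t"
proof
  assume *: "f ^ n \<in> weight_gt V (of_nat n * t)"
  show "f \<in> weight_gt V t"
  proof (rule ccontr)
    assume "f \<notin> weight_gt V t"
    then obtain s where s: "s \<le> t" "f \<in> weight_ge V s" "f \<notin> weight_gt V s"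
      by (rule weight_attained)
    then have "f ^ n \<in> weight_gt V (of_nat n * s)"
      using * by (auto elim!: weight_gt_mono intro: mult_left_mono)
    with weight_power_not_gt[OF s(2,3)] show False by blast
  qed
qed (use assms weight_gt_power in blast)

text \<open>
  Bounds on the powers that generate a coefficient ideal are bounds on the coefficients themselves.
\<close>

lemma weight_ge_if_power:
  fixes f :: "('k::field, 'n) mpowser"
  assumes "n > 0" "f ^ n \<in> weight_ge V (of_nat n * t)"
  shows "f \<in> weight_ge V t"
proof (rule ccontr)
  assume "f \<notin> weight_ge V t"
  then obtain s where s: "s < t" "f \<in> weight_ge V s" "f \<notin> weight_gt V s"
    by (rule weight_attained_below)
  then have "f ^ n \<in> weight_gt V (of_nat n * s)"
    using assms by (auto elim!: weight_ge_imp_gt intro: mult_strict_left_mono)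
  with weight_power_not_gt[OF s(2,3)] show False by blast
qed

end

section \<open>Expansions in powers of \<open>z - g\<close>\<close>

definition total_degree :: "('n::finite \<Rightarrow>\<^sub>0 nat) \<Rightarrow> int" where
  "total_degree \<alpha> = (\<Sum>i\<in>UNIV. int (Poly_Mapping.lookup \<alpha> i))"

lemma total_degree_nonneg: "0 \<le> total_degree \<alpha>"
  by (simp add: total_degree_def sum_nonneg)

lemma total_degree_eq_0_iff: "total_degree \<alpha> = 0 \<longleftrightarrow> \<alpha> = 0"
  by (auto simp: total_degree_def sum_nonneg_eq_0_iff poly_mapping_eq_iff fun_eq_iff)

interpretation total_degree: monomial_weight total_degree
proof
  show "\<exists>\<alpha>\<in>A. \<forall>\<beta>\<in>A. total_degree \<alpha> \<le> total_degree \<beta>"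
    if A: "A \<noteq> {}" for A :: "('n::finite \<Rightarrow>\<^sub>0 nat) set"
  proof -
    obtain x where "x \<in> A" using A by blast
    then obtain \<alpha> where "\<alpha> \<in> A" "\<forall>\<beta>. \<beta> \<in> A \<longrightarrow> nat (total_degree \<alpha>) \<le> nat (total_degree \<beta>)"
      using ex_has_least_nat[of "\<lambda>\<alpha>. \<alpha> \<in> A" x "\<lambda>\<alpha>. nat (total_degree \<alpha>)"] by blast
    then show ?thesis
      by (metis nat_le_eq_zle nat_le_iff nat_le_0 total_degree_nonneg int_nat_eq of_nat_le_iff)
  qed
qed (simp_all add: total_degree_def lookup_add sum.distrib sum_nonneg)

lemma mem_weight_ge_1_iff: "g \<in> weight_ge total_degree 1 \<longleftrightarrow> mcoeff g 0 = 0"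
proof -
  have "1 \<le> total_degree \<alpha> \<longleftrightarrow> \<alpha> \<noteq> 0" for \<alpha> :: "'b::finite \<Rightarrow>\<^sub>0 nat"
    using total_degree_eq_0_iff[of \<alpha>] total_degree_nonneg[of \<alpha>] by linarith
  then show ?thesis
    by (auto simp: weight_ge_def)
qed

lemma mcoeff_mult_power_eq_0:
  fixes g h :: "('k::comm_ring_1, 'n::finite) mpowser"
  assumes "mcoeff g 0 = 0" "total_degree \<gamma> < int i"
  shows "mcoeff (h * g ^ i) \<gamma> = 0"
proof -
  have "h * g ^ i \<in> weight_ge total_degree (0 + of_nat i * 1)"
    using assms(1) by (intro total_degree.weight_ge_mult total_degree.weight_ge_power
        total_degree.weight_ge_0_all) (simp add: mem_weight_ge_1_iff)
  then show ?thesis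
    using assms(2) by (force simp: weight_ge_def)
qed

text \<open>
  The value \<open>\<Sum> h\<^sub>i g\<^sup>i\<close> of \<open>h \<in> K[[x]][[z]]\<close> at \<open>z = g\<close>.  If \<open>g\<close> has no constant term, then \<open>g\<^sup>i\<close> has order at
  least \<open>i\<close>, so only the terms with \<open>i \<le> |\<gamma>|\<close> contribute to the coefficient at \<open>\<gamma>\<close>.
\<close>

definition eval_at :: "('k::comm_ring_1, 'n::finite) mpowser \<Rightarrow> ('k, 'n) mpowser fps \<Rightarrow> ('k, 'n) mpowser" where
  "eval_at g h = Abs_mpowser (\<lambda>\<gamma>. mcoeff (\<Sum>i\<le>nat (total_degree \<gamma>). fps_nth h i * g ^ i) \<gamma>)"

lemma mcoeff_eval_at:
  fixes g :: "('k::comm_ring_1, 'n::finite) mpowser"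
  assumes "mcoeff g 0 = 0" "total_degree \<gamma> \<le> int N"
  shows "mcoeff (eval_at g h) \<gamma> = mcoeff (\<Sum>i\<le>N. fps_nth h i * g ^ i) \<gamma>"
proof -
  have "(\<Sum>i\<le>nat (total_degree \<gamma>). mcoeff (fps_nth h i * g ^ i) \<gamma>) = (\<Sum>i\<le>N. mcoeff (fps_nth h i * g ^ i) \<gamma>)"
    using assms total_degree_nonneg[of \<gamma>]
    by (intro sum.mono_neutral_left) (auto intro!: mcoeff_mult_power_eq_0)
  then show ?thesis
    by (simp add: eval_at_def)
qed

lemma eval_at_unfold:
  fixes g :: "('k::comm_ring_1, 'n::finite) mpowser"
  assumes g: "mcoeff g 0 = 0"
  shows "eval_at g h = fps_nth h 0 + g * eval_at g (fps_shift 1 h)"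
proof -
  have "mcoeff (eval_at g h) \<gamma> = mcoeff (fps_nth h 0 + g * eval_at g (fps_shift 1 h)) \<gamma>" for \<gamma>
  proof -
    define N where "N = nat (total_degree \<gamma>)"
    have N: "total_degree \<gamma> \<le> int N" by (simp add: N_def)
    have "(\<Sum>i\<le>Suc N. fps_nth h i * g ^ i) = fps_nth h 0 + g * (\<Sum>i\<le>N. fps_nth (fps_shift 1 h) i * g ^ i)"
      by (subst sum.atMost_Suc_shift) (simp add: sum_distrib_left ac_simps)
    moreover have "mcoeff (g * (\<Sum>i\<le>N. fps_nth (fps_shift 1 h) i * g ^ i)) \<gamma> =
        mcoeff (g * eval_at g (fps_shift 1 h)) \<gamma>"
      unfolding mcoeff_mult
    proof (rule sum.cong[OF refl], clarify)
      fix \<alpha> \<beta> :: "'n \<Rightarrow>\<^sub>0 nat" assume [simp]: "\<gamma> = \<alpha> + \<beta>"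
      have "total_degree \<beta> \<le> int N"
        using N total_degree_nonneg[of \<alpha>] by (simp add: total_degree.weight_add)
      then show "mcoeff g \<alpha> * mcoeff (\<Sum>i\<le>N. fps_nth (fps_shift 1 h) i * g ^ i) \<beta> =
          mcoeff g \<alpha> * mcoeff (eval_at g (fps_shift 1 h)) \<beta>"
        using mcoeff_eval_at[OF g, of \<beta> N "fps_shift 1 h"] by simp
    qed
    ultimately show ?thesis
      using mcoeff_eval_at[OF g, of \<gamma> "Suc N" h] N by simp
  qed
  then show ?thesis by (simp add: mpowser_eq_iff)
qed

text \<open>
  Horner's scheme for an infinite series: the remainder is the value at \<open>g\<close>, and the coefficients of the
  quotient are the values at \<open>g\<close> of the tails of \<open>f\<close>.
\<close>

lemma division_by_linear:
  fixes g :: "('k::comm_ring_1, 'n::finite) mpowser"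
  assumes "mcoeff g 0 = 0"
  shows "\<exists>r h. f = fps_const r + (fps_X - fps_const g) * h"
proof (intro exI)
  let ?r = "eval_at g f" and ?h = "Abs_fps (\<lambda>j. eval_at g (fps_shift (Suc j) f))"
  show "f = fps_const ?r + (fps_X - fps_const g) * ?h"
  proof (rule fps_ext)
    fix j
    have "eval_at g (fps_shift j f) = fps_nth f j + g * eval_at g (fps_shift (Suc j) f)"
      using eval_at_unfold[OF assms, of "fps_shift j f"]
      by (simp flip: fps_shift_fps_shift)
    then show "fps_nth f j = fps_nth (fps_const ?r + (fps_X - fps_const g) * ?h) j"
      by (cases j) (simp_all add: left_diff_distrib)
  qed
qed

text \<open>
  Iterated division.  The exact remainder after \<open>N\<close> steps is kept: for growing \<open>N\<close> it yields
  convergence, and for \<open>N = c\<close> it turns the comparison of coefficients into a finite computation.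
\<close>

lemma expansion_exists:
  fixes g :: "('k::comm_ring_1, 'n::finite) mpowser"
  assumes "mcoeff g 0 = 0"
  obtains a H where "\<And>N. f = (\<Sum>i<N. fps_const (a i) * (fps_X - fps_const g) ^ i) + (fps_X - fps_const g) ^ N * H N"
proof -
  let ?y = "fps_X - fps_const g"
  obtain r h where rh: "\<And>f. f = fps_const (r f) + ?y * h f"
    using division_by_linear[OF assms] by metis
  have "f = (\<Sum>i<N. fps_const (r ((h ^^ i) f)) * ?y ^ i) + ?y ^ N * (h ^^ N) f" for N
  proof (induction N)
    case (Suc N)
    have "?y ^ N * (h ^^ N) f = fps_const (r ((h ^^ N) f)) * ?y ^ N + ?y ^ Suc N * (h ^^ Suc N) f"
      by (subst rh) (simp add: algebra_simps)
    with Suc show ?case by (simp add: add.assoc)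
  qed simp
  then show ?thesis by (rule that)
qed

section \<open>The local rings\<close>

lemma is_ideal_iff:
  "is_ideal I \<longleftrightarrow> 0 \<in> I \<and> (\<forall>x\<in>I. \<forall>y\<in>I. x + y \<in> I) \<and> (\<forall>r. \<forall>x\<in>I. r * x \<in> I)"
proof -
  interpret module "(*) :: 'a \<Rightarrow> 'a \<Rightarrow> 'a"
    by standard (simp_all add: algebra_simps)
  show ?thesis by (auto simp: is_ideal_def subspace_def)
qed

lemma ideal_gen_least: "is_ideal I \<Longrightarrow> S \<subseteq> I \<Longrightarrow> ideal_gen S \<subseteq> I"
  and ideal_gen_superset: "S \<subseteq> ideal_gen S"
  and is_ideal_ideal_gen: "is_ideal (ideal_gen S)"
proof -
  interpret module "(*) :: 'a \<Rightarrow> 'a \<Rightarrow> 'a"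
    by standard (simp_all add: algebra_simps)
  show "is_ideal I \<Longrightarrow> S \<subseteq> I \<Longrightarrow> ideal_gen S \<subseteq> I" "S \<subseteq> ideal_gen S" "is_ideal (ideal_gen S)"
    by (simp_all add: is_ideal_def ideal_gen_def span_minimal span_superset)
qed

text \<open>If the non-units form an ideal, every proper ideal lies in it.\<close>

lemma the_max_ideal_eq:
  fixes M :: "'a::comm_ring_1 set"
  assumes M: "is_ideal M" "1 \<notin> M" "\<And>x. x \<notin> M \<Longrightarrow> x dvd 1"
  shows "the_max_ideal = M"
  unfolding the_max_ideal_def
proof (rule the_equality)
  have proper: "I \<subseteq> M" if "is_ideal I" "I \<noteq> UNIV" for I
  proof
    fix x assume "x \<in> I"
    show "x \<in> M"
    proof (rule ccontr)
      assume "x \<notin> M"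
      then have "x dvd 1" by (rule M(3))
      then obtain u where "1 = x * u" by (rule dvdE)
      then have "r = (r * u) * x" for r by (simp add: ac_simps)
      with \<open>x \<in> I\<close> \<open>is_ideal I\<close> have "r \<in> I" for r
        unfolding is_ideal_iff by metis
      with that(2) show False by auto
    qed
  qed
  with M show "is_maximal_ideal M" by (auto simp: is_maximal_ideal_def)
  fix M' :: "'a set" assume "is_maximal_ideal M'"
  then show "M' = M"
    using proper[of M'] M by (auto simp: is_maximal_ideal_def)
qed

lemma mpowser_unit:
  fixes f :: "('k::field, 'n::finite) mpowser"
  assumes "mcoeff f 0 \<noteq> 0"
  shows "f dvd 1"
proof -
  define a :: "('k, 'n) mpowser"
    where "a = Abs_mpowser (\<lambda>\<gamma>. if \<gamma> = 0 then inverse (mcoeff f 0) else 0)"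
  have [simp]: "mcoeff a 0 = inverse (mcoeff f 0)" by (simp add: a_def)
  \<comment> \<open>the geometric series in \<open>t = 1 - a f\<close>, which has no constant term\<close>
  define t where "t = 1 - a * f"
  define S where "S = eval_at t (Abs_fps (\<lambda>_. 1))"
  have "mcoeff t 0 = 0"
    using assms by (simp add: t_def mcoeff_1)
  moreover have "fps_shift 1 (Abs_fps (\<lambda>_. 1)) = (Abs_fps (\<lambda>_. 1) :: ('k, 'n) mpowser fps)"
    by (simp add: fps_eq_iff)
  ultimately have "S = 1 + t * S"
    using eval_at_unfold[of t "Abs_fps (\<lambda>_. 1)"] by (simp add: S_def)
  then have "1 = f * (a * S)"
    by (simp add: t_def algebra_simps)
  then show ?thesis by (rule dvdI)
qed

lemma the_max_ideal_mpowser: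
  "(the_max_ideal :: ('k::field, 'n::finite) mpowser set) = {f. mcoeff f 0 = 0}"
  by (rule the_max_ideal_eq) (auto simp: is_ideal_iff mcoeff_1 mpowser_unit)

lemma the_max_ideal_mpowser_fps:
  "(the_max_ideal :: ('k::field, 'n::finite) mpowser fps set) = {f. mcoeff (fps_nth f 0) 0 = 0}"
proof (rule the_max_ideal_eq)
  fix f :: "('k, 'n) mpowser fps" assume "f \<notin> {f. mcoeff (fps_nth f 0) 0 = 0}"
  then have "fps_nth f 0 dvd 1"
    by (intro mpowser_unit) simp
  then have "\<exists>k. 1 = fps_nth f 0 * k"
    by (simp only: dvd_def)
  then show "f dvd 1"
    unfolding dvd_def by (simp only: fps_is_left_unit_iff_zeroth_is_left_unit)
qed (auto simp: is_ideal_iff mcoeff_1)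

lemma power_mult_mem_ideal_power: "y \<in> I \<Longrightarrow> y ^ N * h \<in> ideal_power I N"
proof (induction N)
  case (Suc N)
  then have "y * (y ^ N * h) \<in> {a * b | a b. a \<in> I \<and> b \<in> ideal_power I N}"
    by blast
  then show ?case
    using ideal_gen_superset by (force simp: mult.assoc)
qed simp

lemma ideal_power_subset:
  assumes "is_ideal I" "k > 0"
  shows "ideal_power I k \<subseteq> I"
proof -
  obtain j where [simp]: "k = Suc j" using assms(2) by (cases k) auto
  show ?thesis
    unfolding \<open>k = Suc j\<close> ideal_power.simps using assms(1)
    by (intro ideal_gen_least) (auto simp: is_ideal_iff, metis mult.commute)
qed

lemma ideal_power_antimono:
  assumes "is_ideal I" "j \<le> k"
  shows "ideal_power I k \<subseteq> ideal_power I j"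
  using assms(2)
proof (induction rule: dec_induct)
  case (step n)
  have "is_ideal (ideal_power I n)"
    by (cases n) (auto simp: is_ideal_ideal_gen, simp add: is_ideal_iff)
  then have "ideal_power I (Suc n) \<subseteq> ideal_power I n"
    unfolding ideal_power.simps by (intro ideal_gen_least) (auto simp: is_ideal_iff)
  with step show ?case by blast
qed simp

text \<open>
  Elements of the \<open>k\<close>-th power of the maximal ideal have no terms of total degree less than \<open>k\<close>; this
  separates distinct series and makes expansions in \<open>z\<close> unique.
\<close>

lemma ideal_power_max_ideal_vanishing:
  fixes f :: "('k::field, 'n::finite) mpowser fps"
  assumes "f \<in> ideal_power the_max_ideal k" "int j + total_degree \<gamma> < int k"
  shows "mcoeff (fps_nth f j) \<gamma> = 0"
proof -
  define vanish where "vanish k = {f :: ('k, 'n) mpowser fps.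
    \<forall>j \<gamma>. int j + total_degree \<gamma> < int k \<longrightarrow> mcoeff (fps_nth f j) \<gamma> = 0}" for k
  have prod: "a * b \<in> vanish (k' + k)" if ab: "a \<in> vanish k'" "b \<in> vanish k" for a b k k'
    unfolding vanish_def
  proof safe
    fix j and \<gamma> :: "'n \<Rightarrow>\<^sub>0 nat" assume *: "int j + total_degree \<gamma> < int (k' + k)"
    have "mcoeff (fps_nth a i * fps_nth b (j - i)) \<gamma> = 0" if "i \<le> j" for i
    proof (rule ccontr)
      assume "mcoeff (fps_nth a i * fps_nth b (j - i)) \<gamma> \<noteq> 0"
      then obtain \<alpha> \<beta> where "\<alpha> + \<beta> = \<gamma>" "mcoeff (fps_nth a i) \<alpha> \<noteq> 0" "mcoeff (fps_nth b (j - i)) \<beta> \<noteq> 0"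
        by (rule mcoeff_mult_nonzeroE)
      moreover from this have "int k' \<le> int i + total_degree \<alpha>" "int k \<le> int (j - i) + total_degree \<beta>"
        using ab by (auto simp: vanish_def not_less[symmetric])
      ultimately show False
        using * that by (auto simp: total_degree.weight_add of_nat_diff)
    qed
    then show "mcoeff (fps_nth (a * b) j) \<gamma> = 0"
      by (simp add: fps_mult_nth)
  qed
  have vanish_0: "vanish 0 = UNIV"
    by (auto simp: vanish_def) (smt (verit) total_degree_nonneg of_nat_0_le_iff)
  have ideal: "is_ideal (vanish k)" for k
    using prod[of _ 0 _ k] by (auto simp: is_ideal_iff vanish_0) (auto simp: vanish_def)
  have max: "the_max_ideal \<subseteq> vanish 1"
  proof
    fix f :: "('k, 'n) mpowser fps" assume f: "f \<in> the_max_ideal"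
    show "f \<in> vanish 1"
      unfolding vanish_def
    proof safe
      fix j and \<gamma> :: "'n \<Rightarrow>\<^sub>0 nat" assume *: "int j + total_degree \<gamma> < int 1"
      then have "j = 0" "total_degree \<gamma> = 0" using total_degree_nonneg[of \<gamma>] by linarith+
      with f show "mcoeff (fps_nth f j) \<gamma> = 0"
        by (simp add: total_degree_eq_0_iff the_max_ideal_mpowser_fps)
    qed
  qed
  have "ideal_power the_max_ideal k \<subseteq> vanish k"
  proof (induction k)
    case (Suc k)
    then have "{a * b | a b. a \<in> the_max_ideal \<and> b \<in> ideal_power the_max_ideal k} \<subseteq> vanish (1 + k)"
      using prod[of _ 1 _ k] max by blast
    then show ?case
      using ideal_gen_least[OF ideal[of "Suc k"]] by simp
  qed (simp add: vanish_0)
  with assms show ?thesis by (auto simp: vanish_def)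
qed

lemma is_ideal_the_max_ideal:
  "is_ideal (the_max_ideal :: ('k::field, 'n::finite) mpowser set)"
  "is_ideal (the_max_ideal :: ('k::field, 'n::finite) mpowser fps set)"
  by (auto simp: the_max_ideal_mpowser the_max_ideal_mpowser_fps is_ideal_iff)

lemma expands_in_if_divisible:
  fixes y :: "('k::field, 'n::finite) mpowser fps"
  assumes "y \<in> the_max_ideal"
    and "\<And>N. f = (\<Sum>i<N. fps_const (a i) * y ^ i) + y ^ N * H N"
  shows "expands_in y f a"
  unfolding expands_in_def
proof
  fix k
  show "\<forall>\<^sub>F N in sequentially. f - (\<Sum>i<N. fps_const (a i) * y ^ i) \<in> ideal_power the_max_ideal k"
  proof (rule eventually_sequentiallyI[of k])
    fix N assume "k \<le> N"
    have "f - (\<Sum>i<N. fps_const (a i) * y ^ i) = y ^ N * H N"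
      using assms(2)[of N] by (simp add: algebra_simps)
    also have "\<dots> \<in> ideal_power the_max_ideal N"
      by (rule power_mult_mem_ideal_power) fact
    also have "\<dots> \<subseteq> ideal_power the_max_ideal k"
      by (rule ideal_power_antimono[OF is_ideal_the_max_ideal(2)]) fact
    finally show "f - (\<Sum>i<N. fps_const (a i) * y ^ i) \<in> ideal_power the_max_ideal k" .
  qed
qed

lemma expansion_in_shifted_variable:
  fixes g :: "('k::field, 'n::finite) mpowser"
  assumes "mcoeff g 0 = 0"
  obtains a H where "expands_in (fps_X - fps_const g) f a"
    and "\<And>N. f = (\<Sum>i<N. fps_const (a i) * (fps_X - fps_const g) ^ i) + (fps_X - fps_const g) ^ N * H N"
proof -
  obtain a H where *: "\<And>N. f = (\<Sum>i<N. fps_const (a i) * (fps_X - fps_const g) ^ i) + (fps_X - fps_const g) ^ N * H N"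
    using expansion_exists[OF assms] by blast
  moreover have "expands_in (fps_X - fps_const g) f a"
    using assms by (intro expands_in_if_divisible[OF _ *]) (simp add: the_max_ideal_mpowser_fps)
  ultimately show ?thesis using that by blast
qed

lemma nth_sum_fps_X: "fps_nth (\<Sum>i<N. fps_const (a i) * fps_X ^ i) j = (if j < N then a j else 0)"
  for a :: "nat \<Rightarrow> 'a::comm_ring_1"
proof -
  have "fps_nth (\<Sum>i<N. fps_const (a i) * fps_X ^ i) j = (\<Sum>i<N. if i = j then a i else 0)"
    unfolding fps_sum_nth by (intro sum.cong) auto
  then show ?thesis by simp
qed

lemma expands_in_fps_X_iff:
  fixes f :: "('k::field, 'n::finite) mpowser fps"
  shows "expands_in fps_X f a \<longleftrightarrow> a = fps_nth f"
proof
  assume *: "expands_in fps_X f a"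
  show "a = fps_nth f"
  proof
    fix j
    have "mcoeff (a j) \<gamma> = mcoeff (fps_nth f j) \<gamma>" for \<gamma>
    proof -
      define k where "k = Suc (j + nat (total_degree \<gamma>))"
      have "\<forall>\<^sub>F N in sequentially. f - (\<Sum>i<N. fps_const (a i) * fps_X ^ i) \<in> ideal_power the_max_ideal k \<and> j < N"
        using * by (intro eventually_conj eventually_gt_at_top) (simp add: expands_in_def)
      then obtain N where N: "f - (\<Sum>i<N. fps_const (a i) * fps_X ^ i) \<in> ideal_power the_max_ideal k" "j < N"
        using eventually_happens'[OF sequentially_bot] by blast
      have "mcoeff (fps_nth (f - (\<Sum>i<N. fps_const (a i) * fps_X ^ i)) j) \<gamma> = 0"
        by (rule ideal_power_max_ideal_vanishing[OF N(1)]) (simp add: k_def total_degree_nonneg)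
      then show ?thesis
        using N(2) by (simp only: fps_sub_nth nth_sum_fps_X) simp
    qed
    then show "a j = fps_nth f j" by (simp add: mpowser_eq_iff)
  qed
next
  assume a: "a = fps_nth f"
  have "f = (\<Sum>i<N. fps_const (a i) * fps_X ^ i) + fps_X ^ N * fps_shift N f" for N
    by (rule fps_ext) (simp add: nth_sum_fps_X fps_X_power_mult_nth a del: fps_sum_nth)
  then show "expands_in fps_X f a"
    by (rule expands_in_if_divisible[rotated]) (simp add: the_max_ideal_mpowser_fps)
qed

lemma elem_ord_ge_1_imp:
  fixes g :: "('k::field, 'n::finite) mpowser"
  assumes "elem_ord g \<ge> 1"
  shows "mcoeff g 0 = 0"
proof -
  have "0 < Sup {enat n |n. ideal_gen {g} \<subseteq> ideal_power the_max_ideal n}"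
    using less_le_trans[OF zero_less_one assms] by (simp only: elem_ord_def ideal_ord_def)
  then obtain n where "n > 0" "ideal_gen {g} \<subseteq> ideal_power the_max_ideal n"
    by (auto simp: less_Sup_iff zero_enat_def)
  then have "g \<in> the_max_ideal"
    using ideal_power_subset[OF is_ideal_the_max_ideal(1)] ideal_gen_superset[of "{g}"] by blast
  then show ?thesis by (simp add: the_max_ideal_mpowser)
qed

section \<open>Binomial coefficients\<close>

lemma CHAR_poly_eq: "CHAR('a::comm_ring_1 poly) = CHAR('a)"
  by (rule CHAR_eqI) (simp_all add: of_nat_poly of_nat_eq_0_iff_char_dvd)

text \<open>
  Write \<open>c = q d\<close> with \<open>d\<close> prime to the characteristic \<open>p\<close>.  By the Frobenius identity the binomial
  coefficients of \<open>c\<close> modulo \<open>p\<close> are those of \<open>d\<close>, spread out to the multiples of \<open>q\<close>: the one before the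
  last is \<open>d\<close>, at index \<open>c - q\<close>, with nothing between it and the last.
  In characteristic \<open>0\<close>, where \<open>q = 1\<close>, only \<open>c \<noteq> 0\<close> is at stake.
\<close>

lemma char_part_binomial:
  fixes c :: nat
  assumes "c > 0"
  defines "q \<equiv> char_part TYPE('k::field) c"
  shows "0 < q" and "q \<le> c"
    and "of_nat (c choose (c - q)) \<noteq> (0 :: 'k)"
    and "\<And>i. c - q < i \<Longrightarrow> i < c \<Longrightarrow> of_nat (c choose i) = (0 :: 'k)"
proof -
  have "0 < q \<and> q \<le> c \<and> of_nat (c choose (c - q)) \<noteq> (0 :: 'k) \<and>
      (\<forall>i. c - q < i \<and> i < c \<longrightarrow> of_nat (c choose i) = (0 :: 'k))"
  proof (cases "CHAR('k) = 0")
    case True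
    then have "q = 1" by (simp add: q_def char_part_def)
    moreover have "c choose (c - 1) = c"
      using assms(1) binomial_symmetric[of 1 c] by simp
    ultimately show ?thesis
      using assms(1) True by (auto simp: of_nat_eq_0_iff_char_dvd)
  next
    case False
    define p where "p = CHAR('k)"
    have p: "prime p"
      using False prime_CHAR_semidom[where ?'a = 'k] by (simp add: p_def)
    define m where "m = multiplicity p c"
    have q: "q = p ^ m"
      using False by (simp add: q_def char_part_def p_def m_def)
    obtain d where d: "c = p ^ m * d" "\<not> p dvd d"
      using multiplicity_decompose'[of c p] assms(1) p unfolding m_def
      by (metis not_prime_unit less_numeral_extra(3))
    have "d > 0" using assms(1) d(1) by (cases d) auto
    have "0 < q" using p by (simp add: q prime_gt_0_nat)
    have c: "c = q * d" by (simp add: d(1) q)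
    \<comment> \<open>\<open>(1 + X)\<^sup>c = (1 + X\<^sup>q)\<^sup>d\<close> in characteristic \<open>p\<close>\<close>
    have "[:1, 1 :: 'k:] ^ c = ([:1:] + monom 1 1) ^ (q * d)"
      by (simp add: c monom_altdef)
    also have "\<dots> = ([:1:] ^ q + monom 1 1 ^ q) ^ d"
      unfolding power_mult
      by (subst freshmans_dream'[where n = m]) (use p in \<open>simp_all add: CHAR_poly_eq q p_def\<close>)
    also have "\<dots> = (monom 1 q + 1) ^ d"
      by (simp add: monom_power one_pCons[symmetric] add.commute)
    also have "\<dots> = (\<Sum>j\<le>d. of_nat (d choose j) * monom 1 (q * j))"
      by (simp add: binomial_ring monom_power)
    finally have expand: "[:1, 1 :: 'k:] ^ c = (\<Sum>j\<le>d. of_nat (d choose j) * monom 1 (q * j))" .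
    have *: "of_nat (c choose i) = (\<Sum>j\<le>d. if q * j = i then of_nat (d choose j) else (0 :: 'k))" if "i \<le> c" for i
    proof -
      have "of_nat (c choose i) = coeff ([:1, 1 :: 'k:] ^ c) i"
        using that by (simp add: coeff_linear_poly_power)
      also have "\<dots> = (\<Sum>j\<le>d. if q * j = i then of_nat (d choose j) else 0)"
        unfolding expand by (auto simp: coeff_sum of_nat_poly intro!: sum.cong)
      finally show ?thesis .
    qed
    have "of_nat (c choose (c - q)) = (\<Sum>j\<le>d. if j = d - 1 then of_nat (d choose j) else (0 :: 'k))"
      unfolding *[OF diff_le_self]
    proof (rule sum.cong[OF refl])
      fix j
      have "c - q = q * (d - 1)" by (simp add: c diff_mult_distrib2)
      then have "q * j = c - q \<longleftrightarrow> j = d - 1" using \<open>0 < q\<close> by simp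
      then show "(if q * j = c - q then of_nat (d choose j) else (0 :: 'k)) =
          (if j = d - 1 then of_nat (d choose j) else 0)" by simp
    qed
    also have "\<dots> = of_nat d"
      using \<open>d > 0\<close> binomial_symmetric[of 1 d] by simp
    finally have "of_nat (c choose (c - q)) \<noteq> (0 :: 'k)"
      using d(2) by (simp add: of_nat_eq_0_iff_char_dvd p_def)
    moreover have "of_nat (c choose i) = (0 :: 'k)" if i: "c - q < i" "i < c" for i
    proof -
      have "q * j \<noteq> i" for j
      proof
        assume j: "q * j = i"
        then have "j < d" using i(2) c by auto
        then have "q * j \<le> q * (d - 1)" by (intro mult_le_mono2) linarith
        then show False using i(1) j by (simp add: c diff_mult_distrib2)
      qed
      then show ?thesis using i(2) by (simp add: *)
    qed
    moreover have "q \<le> c" using \<open>d > 0\<close> by (simp add: c)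
    ultimately show ?thesis using \<open>0 < q\<close> by blast
  qed
  then show "0 < q" "q \<le> c" "of_nat (c choose (c - q)) \<noteq> (0 :: 'k)"
    "\<And>i. c - q < i \<Longrightarrow> i < c \<Longrightarrow> of_nat (c choose i) = (0 :: 'k)"
    by blast+
qed

section \<open>Coefficients before and after the change of coordinates\<close>

lemma nth_linear_power:
  fixes g :: "'a::comm_ring_1"
  shows "fps_nth ((fps_X - fps_const g) ^ n) k = of_nat (n choose k) * (- g) ^ (n - k)"
proof (induction n arbitrary: k)
  case 0
  show ?case by (cases k) auto
next
  case (Suc n)
  show ?case
  proof (cases k)
    case (Suc j)
    have "(- g) * (of_nat (n choose Suc j) * (- g) ^ (n - Suc j)) = of_nat (n choose Suc j) * (- g) ^ (n - j)"
    proof (cases "Suc j \<le> n")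
      case True
      then have "n - j = Suc (n - Suc j)" by simp
      then show ?thesis by (simp add: mult.left_commute)
    qed (simp add: binomial_eq_0)
    then show ?thesis
      by (simp add: Suc.IH Suc left_diff_distrib distrib_right)
  qed (simp add: Suc.IH left_diff_distrib)
qed

text \<open>
  The coefficients in \<open>z\<close> from an expansion in \<open>z - g\<close> truncated at \<open>c\<close>.  In \<open>(z - g)\<^sup>c H\<close>, the coefficient
  of \<open>z\<^sup>k\<close> is governed by \<open>H\<^sub>0\<close> modulo one further power of \<open>g\<close>, and \<open>H\<^sub>0\<close> agrees with \<open>f\<^sub>c\<close> modulo \<open>g\<close>, as the
  case \<open>k = c\<close> shows.  So \<open>f\<^sub>c\<close>, which is a unit for a \<open>z\<close>-regular \<open>f\<close>, can stand in for \<open>H\<^sub>0\<close>.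
\<close>

lemma coefficient_of_expansion:
  fixes g :: "'a::comm_ring_1"
  defines "y \<equiv> fps_X - fps_const g"
  assumes f: "f = (\<Sum>i<c. fps_const (a i) * y ^ i) + y ^ c * H" and "k \<le> c"
  obtains s where "fps_nth f k = (\<Sum>i<c. a i * (of_nat (i choose k) * (- g) ^ (i - k))) +
    of_nat (c choose k) * (- g) ^ (c - k) * fps_nth f c + g ^ Suc (c - k) * s"
proof -
  define B where "B k = (\<Sum>i<c. a i * (of_nat (i choose k) * (- g) ^ (i - k)))" for k
  have *: "\<exists>s. fps_nth f k = B k + of_nat (c choose k) * (- g) ^ (c - k) * fps_nth H 0 + g ^ Suc (c - k) * s"
    if "k \<le> c" for k
  proof -
    have "fps_nth (y ^ c * H) k = (\<Sum>j\<le>k. fps_nth (y ^ c) j * fps_nth H (k - j))"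
      by (simp add: fps_mult_nth atLeast0AtMost)
    also have "\<dots> = fps_nth (y ^ c) k * fps_nth H 0 + (\<Sum>j<k. fps_nth (y ^ c) j * fps_nth H (k - j))"
      by (simp add: lessThan_Suc_atMost[symmetric] add.commute)
    also have "fps_nth (y ^ c) k = of_nat (c choose k) * (- g) ^ (c - k)"
      by (simp add: y_def nth_linear_power)
    finally have 1: "fps_nth (y ^ c * H) k = of_nat (c choose k) * (- g) ^ (c - k) * fps_nth H 0 +
      (\<Sum>j<k. fps_nth (y ^ c) j * fps_nth H (k - j))" .
    have "g ^ Suc (c - k) dvd fps_nth (y ^ c) j * fps_nth H (k - j)" if "j < k" for j
    proof -
      have "g ^ Suc (c - k) dvd g ^ (c - j)"
        using that \<open>k \<le> c\<close> by (intro le_imp_power_dvd) auto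
      also have "\<dots> dvd (- g) ^ (c - j)"
        by (metis dvd_minus_iff dvd_refl dvd_power_same minus_dvd_iff)
      finally show ?thesis
        unfolding y_def nth_linear_power by (intro dvd_mult2 dvd_mult)
    qed
    then have "g ^ Suc (c - k) dvd (\<Sum>j<k. fps_nth (y ^ c) j * fps_nth H (k - j))"
      by (intro dvd_sum) auto
    then obtain s where s: "(\<Sum>j<k. fps_nth (y ^ c) j * fps_nth H (k - j)) = g ^ Suc (c - k) * s" ..
    have "fps_nth f k = B k + fps_nth (y ^ c * H) k"
      by (subst f) (simp add: fps_sum_nth B_def y_def nth_linear_power)
    with 1 s show ?thesis by (auto simp: add.assoc)
  qed
  from *[OF \<open>k \<le> c\<close>] obtain s where s:
    "fps_nth f k = B k + of_nat (c choose k) * (- g) ^ (c - k) * fps_nth H 0 + g ^ Suc (c - k) * s" ..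
  have "B c = 0" by (simp add: B_def binomial_eq_0)
  with *[of c] obtain s' where s': "fps_nth f c = fps_nth H 0 + g * s'" by auto
  \<comment> \<open>replacing \<open>H\<close> at \<open>0\<close> by \<open>f\<close> at \<open>c\<close> costs a multiple of one more power of \<open>g\<close>\<close>
  define r where "r = of_nat (c choose k) * (-1) ^ (c - k) * s'"
  have "of_nat (c choose k) * (- g) ^ (c - k) * (g * s') = g ^ Suc (c - k) * r"
    by (subst power_minus) (simp add: r_def ac_simps)
  then have "fps_nth f k = B k + of_nat (c choose k) * (- g) ^ (c - k) * fps_nth f c + g ^ Suc (c - k) * (s - r)"
    by (simp add: s s' distrib_left right_diff_distrib)
  then show ?thesis
    using that by (simp add: B_def)
qed

context monomial_weight
begin

lemma weight_unit:
  fixes u :: "('k::comm_ring_1, 'n) mpowser"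
  assumes "mcoeff u 0 \<noteq> 0"
  shows "u \<in> weight_ge V 0" "u \<notin> weight_gt V 0"
  using assms by (auto simp: weight_ge_0_all weight_gt_def weight_0 intro!: exI[of _ 0])

text \<open>
  The bounds \<open>(c - i) t\<close> are the ones that the substitution \<open>y = z - g\<close> respects when \<open>g\<close> has value at least
  \<open>t\<close>; if \<open>g\<close> only has value at least \<open>s \<le> t\<close>, the terms still keep the weaker bounds \<open>(c - k) s\<close>.
\<close>

lemma weight_gt_taylor_term:
  fixes a g :: "('k::comm_ring_1, 'n) mpowser"
  assumes "a \<in> weight_gt V (of_nat (c - i) * t)" "g \<in> weight_ge V s" "s \<le> t" "i \<le> c" "k \<le> c"
  shows "a * (of_nat (i choose k) * (- g) ^ (i - k)) \<in> weight_gt V (of_nat (c - k) * s)"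
proof (cases "k \<le> i")
  case True
  have "(- g) ^ (i - k) * of_nat (i choose k) \<in> weight_ge V (of_nat (i - k) * s)"
    using assms(2) by (intro weight_ge_mult_right weight_ge_power weight_ge_uminus)
  then have "a * (of_nat (i choose k) * (- g) ^ (i - k)) \<in> weight_gt V (of_nat (c - i) * t + of_nat (i - k) * s)"
    using assms(1) by (intro weight_gt_mult_ge) (simp_all add: mult.commute)
  moreover have "of_nat (c - k) * s \<le> of_nat (c - i) * t + of_nat (i - k) * s"
  proof -
    have "of_nat (c - k) * s = of_nat (c - i) * s + of_nat (i - k) * s"
      using True assms(4) by (simp flip: distrib_right of_nat_add)
    then show ?thesis
      using assms(3) by (simp add: mult_left_mono)
  qed
  ultimately show ?thesis by (rule weight_gt_mono)
qed (simp add: binomial_eq_0 weight_gt_0)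

text \<open>
  Were the value \<open>s\<close> of \<open>g\<close> less than \<open>t\<close>, then \<open>f\<^sub>0\<close> would be \<open>g\<^sup>c\<close> times a unit up to terms of value greater
  than \<open>c s\<close>, hence of value \<open>c s < c t\<close>.  Gathering all multiples of \<open>g\<^sup>c\<close> into one unit lets the argument
  cover \<open>s = 0\<close>, where higher powers of \<open>g\<close> need not have larger value.
\<close>

lemma weight_of_shift_ge:
  fixes f :: "('k::field, 'n) mpowser fps"
  assumes f: "f = (\<Sum>i<c. fps_const (a i) * (fps_X - fps_const g) ^ i) + (fps_X - fps_const g) ^ c * H"
    and a: "\<And>i. i < c \<Longrightarrow> a i \<in> weight_gt V (of_nat (c - i) * t)"
    and "fps_nth f 0 \<in> weight_ge V (of_nat c * t)" "c > 0"
    and unit: "mcoeff (fps_nth f c) 0 \<noteq> 0" and g: "mcoeff g 0 = 0"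
  shows "g \<in> weight_ge V t"
proof (rule ccontr)
  assume "g \<notin> weight_ge V t"
  then obtain s where s: "s < t" "g \<in> weight_ge V s" "g \<notin> weight_gt V s"
    by (rule weight_attained_below)
  obtain r where r: "fps_nth f 0 = (\<Sum>i<c. a i * (of_nat (i choose 0) * (- g) ^ (i - 0))) +
      of_nat (c choose 0) * (- g) ^ (c - 0) * fps_nth f c + g ^ Suc (c - 0) * r"
    using coefficient_of_expansion[OF f, of 0] by blast
  \<comment> \<open>the cofactor of \<open>g ^ c\<close> in the last two terms\<close>
  define u where "u = (-1) ^ c * fps_nth f c + g * r"
  have "mcoeff ((-1) ^ c :: ('k, 'n) mpowser) 0 = (-1) ^ c"
    by (induction c) (auto simp: mcoeff_1)
  then have "mcoeff u 0 \<noteq> 0"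
    using unit g by (simp add: u_def)
  then have "g ^ c * u \<notin> weight_gt V (of_nat c * s + 0)"
    by (intro weight_mult_not_gt weight_ge_power weight_power_not_gt weight_unit s)
  moreover have "g ^ c * u \<in> weight_gt V (of_nat c * s)"
  proof -
    have "g ^ c * u = fps_nth f 0 - (\<Sum>i<c. a i * (of_nat (i choose 0) * (- g) ^ (i - 0)))"
      unfolding r u_def by (subst power_minus) (simp add: algebra_simps)
    moreover have "fps_nth f 0 \<in> weight_gt V (of_nat c * s)"
      using assms(3,4) s(1) by (auto elim!: weight_ge_imp_gt intro: mult_strict_left_mono)
    moreover have "a i * (of_nat (i choose 0) * (- g) ^ (i - 0)) \<in> weight_gt V (of_nat (c - 0) * s)" if "i < c" for i
      using s that by (intro weight_gt_taylor_term[where t = t] a) auto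
    ultimately show ?thesis
      by (auto intro!: weight_gt_diff weight_gt_sum)
  qed
  ultimately show False by simp
qed

lemma coefficient_mod_higher_weight:
  fixes f :: "('k::comm_ring_1, 'n) mpowser fps"
  assumes f: "f = (\<Sum>i<c. fps_const (a i) * (fps_X - fps_const g) ^ i) + (fps_X - fps_const g) ^ c * H"
    and a: "\<And>i. i < c \<Longrightarrow> a i \<in> weight_gt V (of_nat (c - i) * t)"
    and "0 < t" "g \<in> weight_ge V t" "k \<le> c"
  shows "fps_nth f k - of_nat (c choose k) * (- g) ^ (c - k) * fps_nth f c \<in> weight_gt V (of_nat (c - k) * t)"
proof -
  obtain s where "fps_nth f k = (\<Sum>i<c. a i * (of_nat (i choose k) * (- g) ^ (i - k))) +
      of_nat (c choose k) * (- g) ^ (c - k) * fps_nth f c + g ^ Suc (c - k) * s"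
    using coefficient_of_expansion[OF f \<open>k \<le> c\<close>] by blast
  then have "fps_nth f k - of_nat (c choose k) * (- g) ^ (c - k) * fps_nth f c =
      (\<Sum>i<c. a i * (of_nat (i choose k) * (- g) ^ (i - k))) + g ^ Suc (c - k) * s"
    by simp
  moreover have "g ^ Suc (c - k) * s \<in> weight_gt V (of_nat (c - k) * t)"
    using assms by (intro weight_gt_mult_right weight_ge_imp_gt[OF weight_ge_power[of g t]]) auto
  moreover have "a i * (of_nat (i choose k) * (- g) ^ (i - k)) \<in> weight_gt V (of_nat (c - k) * t)" if "i < c" for i
    using assms that by (intro weight_gt_taylor_term[where t = t] a) auto
  ultimately show ?thesis
    by (auto intro!: weight_gt_add weight_gt_sum)
qed

end

section \<open>Values of the weighted order function\<close>

lemma length_weighted_ord [simp]: "length (weighted_ord l w f) = l"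
  and weighted_ord_attained: "f \<noteq> 0 \<Longrightarrow> \<exists>\<alpha>. mcoeff f \<alpha> \<noteq> 0 \<and> weighted_ord l w f = monom_weight l w \<alpha>"
  and weighted_ord_le: "mcoeff f \<alpha> \<noteq> 0 \<Longrightarrow> weighted_ord l w f \<le> monom_weight l w \<alpha>"
proof -
  let ?S = "monom_weight l w ` {\<alpha>. mcoeff f \<alpha> \<noteq> 0}"
  have *: "weighted_ord l w f \<in> ?S \<and> (\<forall>u\<in>?S. weighted_ord l w f \<le> u)" if "f \<noteq> 0"
  proof -
    have "?S \<noteq> {}" using that by (auto simp: mpowser_eq_iff)
    moreover have "length v = l" if "v \<in> ?S" for v using that by auto
    ultimately show ?thesis
      using Least_list[of ?S l] that by (simp add: weighted_ord_def)
  qed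
  then show "length (weighted_ord l w f) = l"
    by (cases "f = 0") (auto simp: weighted_ord_def)
  show "f \<noteq> 0 \<Longrightarrow> \<exists>\<alpha>. mcoeff f \<alpha> \<noteq> 0 \<and> weighted_ord l w f = monom_weight l w \<alpha>"
    using * by blast
  show "mcoeff f \<alpha> \<noteq> 0 \<Longrightarrow> weighted_ord l w f \<le> monom_weight l w \<alpha>"
    using * by (cases "f = 0") auto
qed

lemma weight_ge_if_weighted_ord:
  "monom_weight l w \<mu> \<le> weighted_ord l w f \<Longrightarrow> f \<in> weight_ge (poly_weight l w) (poly_weight l w \<mu>)"
  using weighted_ord_le[of f _ l w] by (auto simp: weight_ge_def poly_weight_le_iff intro: order_trans)

lemma weight_gt_if_weighted_ord:
  "monom_weight l w \<mu> < weighted_ord l w f \<Longrightarrow> f \<in> weight_gt (poly_weight l w) (poly_weight l w \<mu>)"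
  using weighted_ord_le[of f _ l w] by (auto simp: weight_gt_def poly_weight_less_iff intro: less_le_trans)

lemma weighted_ord_eq:
  assumes "f \<in> weight_ge (poly_weight l w) t" "f \<notin> weight_gt (poly_weight l w) t"
  obtains \<alpha> where "f \<noteq> 0" "poly_weight l w \<alpha> = t" "weighted_ord l w f = monom_weight l w \<alpha>"
proof -
  from assms obtain \<alpha> where \<alpha>: "mcoeff f \<alpha> \<noteq> 0" "poly_weight l w \<alpha> = t"
    by (force simp: weight_ge_def weight_gt_def)
  then have "f \<noteq> 0" by auto
  then obtain \<beta> where \<beta>: "mcoeff f \<beta> \<noteq> 0" "weighted_ord l w f = monom_weight l w \<beta>"
    using weighted_ord_attained by blast
  with assms(1) \<alpha> have "poly_weight l w \<alpha> \<le> poly_weight l w \<beta>"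
    by (auto simp: weight_ge_def)
  with weighted_ord_le[OF \<alpha>(1), of l w] \<beta>(2) have "weighted_ord l w f = monom_weight l w \<alpha>"
    by (simp add: poly_weight_le_iff)
  with \<alpha>(2) \<open>f \<noteq> 0\<close> show ?thesis using that by blast
qed

lemma initial_form_eq:
  assumes "f \<in> weight_ge (poly_weight l w) t" "f \<notin> weight_gt (poly_weight l w) t"
  shows "initial_form l w f = weight_part (poly_weight l w) t f"
  using assms
proof (rule weighted_ord_eq)
  fix \<alpha> assume *: "f \<noteq> 0" "poly_weight l w \<alpha> = t" "weighted_ord l w f = monom_weight l w \<alpha>"
  then have "monom_weight l w \<beta> = weighted_ord l w f \<longleftrightarrow> poly_weight l w \<beta> = t" for \<beta>
    using poly_weight_eq_iff[of l w \<beta> \<alpha>] by simp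
  with \<open>f \<noteq> 0\<close> show ?thesis
    by (simp add: initial_form_def weight_part_def)
qed

lemma ext_vec_eq_scale_vec_iff:
  "ext_vec (monom_weight l w \<alpha>) = scale_vec r (monom_weight l w \<mu>) \<longleftrightarrow>
    poly_weight l w \<alpha> = smult r (poly_weight l w \<mu>)"
  using smult_poly_weight_eq_iff[of 1 l w \<alpha> r \<mu>]
  by (auto simp: ext_vec_def scale_vec_def monom_weight_eq)

lemma not_replicate_infinity_less: "length v = l \<Longrightarrow> \<not> replicate l (\<infinity> :: enat) < v"
  by (auto simp: list_less_def lexord_take_index_conv)

lemma z_regular_unit_coefficient: "z_regular c f \<Longrightarrow> mcoeff (fps_nth f c) 0 \<noteq> 0"
proof -
  assume "z_regular c f"
  then obtain u where u: "fps_nth u 0 \<noteq> 0" "Abs_fps (\<lambda>i. mcoeff (fps_nth f i) 0) = fps_X ^ c * u"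
    by (auto simp: z_regular_def)
  from arg_cong[OF u(2), of "\<lambda>h. fps_nth h c"] u(1) show ?thesis
    by (simp add: fps_X_power_mult_nth)
qed

lemma weighted_ord_ideal_attained:
  "S \<noteq> {} \<Longrightarrow> \<exists>h\<in>S. weighted_ord_ideal l w S = weighted_ord l w h"
  and weighted_ord_ideal_le: "h \<in> S \<Longrightarrow> weighted_ord_ideal l w S \<le> weighted_ord l w h"
proof -
  have len: "length v = l" if "v \<in> weighted_ord l w ` S" for v using that by auto
  show "\<exists>h\<in>S. weighted_ord_ideal l w S = weighted_ord l w h" if "S \<noteq> {}"
    using Least_list(1)[of "weighted_ord l w ` S" l] len that by (auto simp: weighted_ord_ideal_def)
  show "weighted_ord_ideal l w S \<le> weighted_ord l w h" if "h \<in> S"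
    using Least_list(2)[of "weighted_ord l w ` S" l] len that by (auto simp: weighted_ord_ideal_def)
qed

section \<open>Initial parts that are pure powers\<close>

definition const_mpowser :: "'k \<Rightarrow> ('k::comm_ring_1, 'n::finite) mpowser" where
  "const_mpowser d = Abs_mpowser (\<lambda>\<gamma>. if \<gamma> = 0 then d else 0)"

lemma mcoeff_const_mpowser [simp]: "mcoeff (const_mpowser d) \<gamma> = (if \<gamma> = 0 then d else 0)"
  by (simp add: const_mpowser_def)

lemma mcoeff_const_mpowser_mult: "mcoeff (const_mpowser d * f) \<gamma> = d * mcoeff f \<gamma>"
proof -
  have "mcoeff (const_mpowser d * f) (0 + \<gamma>) = d * mcoeff f \<gamma>"
    by (subst mcoeff_mult_unique) (auto split: if_splits)
  then show ?thesis by simp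
qed

lemma const_mpowser_power: "const_mpowser d ^ n = const_mpowser (d ^ n)"
  by (induction n) (auto simp: mpowser_eq_iff mcoeff_1 mcoeff_const_mpowser_mult)

lemma of_nat_eq_const_mpowser: "(of_nat n :: ('k::comm_ring_1, 'n::finite) mpowser) = const_mpowser (of_nat n)"
  by (induction n) (auto simp: mpowser_eq_iff mcoeff_1)

context monomial_weight
begin

lemma weight_part_eq_if_diff_gt:
  fixes f h :: "('k::comm_ring_1, 'n) mpowser"
  assumes "f - h \<in> weight_gt V t"
  shows "weight_part V t f = weight_part V t h"
proof -
  have "mcoeff f \<alpha> = mcoeff h \<alpha>" if "V \<alpha> = t" for \<alpha>
    using assms that by (auto simp: weight_gt_def)
  then show ?thesis by (simp add: weight_part_def cong: if_cong)
qed

lemma is_ideal_weight_gt: "is_ideal (weight_gt V t :: ('k::comm_ring_1, 'n) mpowser set)"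
  unfolding is_ideal_iff
  by (metis weight_gt_0 weight_gt_add weight_gt_mult_right mult.commute)

text \<open>
  If \<open>f0\<close> is \<open>b (-g)\<^sup>q f1\<close> up to terms of higher value, with \<open>f1\<close> a unit, then a \<open>q\<close>-th root \<open>d\<close> of the constant
  \<open>b\<close> makes it \<open>f1 h\<^sup>q\<close> with \<open>h = - d g\<close>, and initial parts are multiplicative.
\<close>

lemma initial_part_pure_power:
  fixes f0 f1 g :: "('k::alg_closed_field, 'n) mpowser"
  assumes diff: "f0 - of_nat b * (- g) ^ q * f1 \<in> weight_gt V (of_nat q * t)"
    and b: "of_nat b \<noteq> (0 :: 'k)" and "q > 0"
    and g: "g \<in> weight_ge V t" "g \<notin> weight_gt V t" and f1: "mcoeff f1 0 \<noteq> 0"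
  obtains G where "f0 \<in> weight_ge V (of_nat q * t)" "f0 \<notin> weight_gt V (of_nat q * t)"
    "weight_part V (of_nat q * t) f0 = weight_part V 0 f1 * G ^ q"
proof -
  obtain d :: 'k where d: "d ^ q = of_nat b"
    using nth_root_exists[OF \<open>q > 0\<close>] by blast
  define h where "h = const_mpowser d * (- g)"
  have "d \<noteq> 0" using d b \<open>q > 0\<close> by (metis zero_power)
  then have "const_mpowser d * (- g) \<in> weight_ge V (0 + t)" "const_mpowser d * (- g) \<notin> weight_gt V (0 + t)"
    using g by (intro weight_ge_mult weight_mult_not_gt weight_unit;
      auto simp: weight_gt_def weight_ge_uminus)+
  then have h: "h \<in> weight_ge V t" "h \<notin> weight_gt V t"
    by (simp_all add: h_def)
  define e where "e = f1 * h ^ q"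
  have "of_nat b * (- g) ^ q * f1 = e"
    by (simp only: e_def h_def power_mult_distrib const_mpowser_power d of_nat_eq_const_mpowser ac_simps)
  with diff have fe: "f0 - e \<in> weight_gt V (of_nat q * t)" by simp
  have e: "e \<in> weight_ge V (0 + of_nat q * t)"
    unfolding e_def using h by (intro weight_ge_mult weight_ge_power weight_ge_0_all)
  have e': "e \<notin> weight_gt V (0 + of_nat q * t)"
    unfolding e_def using f1 h
    by (intro weight_mult_not_gt weight_unit weight_ge_power weight_power_not_gt)
  have "e + (f0 - e) \<in> weight_ge V (of_nat q * t)"
    using e weight_gt_imp_ge[OF fe] by (intro weight_ge_add) simp_all
  moreover have "f0 \<notin> weight_gt V (of_nat q * t)"
    using weight_gt_diff[OF _ fe, of f0] e' by auto
  moreover have "weight_part V (of_nat q * t) f0 = weight_part V 0 f1 * weight_part V t h ^ q"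
    using weight_part_eq_if_diff_gt[OF fe]
      weight_part_mult[OF weight_ge_0_all[of f1] weight_ge_power[OF h(1), of q]]
    by (simp add: e_def weight_part_power[OF h(1)])
  ultimately show ?thesis using that by simp
qed

end

section \<open>Clean elements prevent an increase of the value\<close>

theorem proposition5p1p3:
  fixes J :: "('k::alg_closed_field, 'n::finite) mpowser fps set"
    and f :: "('k, 'n) mpowser fps"
    and g :: "('k, 'n) mpowser"
    and w :: "'n \<Rightarrow> nat list"
    and c l :: nat
  assumes "is_ideal J"
    and "c > 0"
    and "ideal_ord J = enat c"
    and "\<forall>i. length (w i) = l"
    and "weighted_ord_ideal l w (coeff_ideal c fps_X J) > replicate l 0"
    and "elem_ord g \<ge> 1"
    and "f \<in> J"
    and "omega_clean l w c (coeff_ideal c fps_X J) f"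
  shows "weighted_ord_ideal l w (coeff_ideal c (fps_X - fps_const g) J)
           \<le> weighted_ord_ideal l w (coeff_ideal c fps_X J)"
proof (rule ccontr)
  define I where "I = coeff_ideal c fps_X J"
  define I' where "I' = coeff_ideal c (fps_X - fps_const g) J"
  define m where "m = weighted_ord_ideal l w I"
  define q where "q = char_part TYPE('k) c"
  assume "\<not> weighted_ord_ideal l w (coeff_ideal c (fps_X - fps_const g) J)
           \<le> weighted_ord_ideal l w (coeff_ideal c fps_X J)"
  then have less: "m < weighted_ord_ideal l w I'"
    by (simp add: m_def I_def I'_def)
  have "0 \<in> I" "0 \<in> I'"
    using is_ideal_ideal_gen by (auto simp: I_def I'_def coeff_ideal_def is_ideal_iff)
  then have "I \<noteq> {}" "I' \<noteq> {}" by auto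
  obtain h where h: "h \<in> I" "m = weighted_ord l w h"
    using weighted_ord_ideal_attained[OF \<open>I \<noteq> {}\<close>, of l w] by (auto simp: m_def)
  obtain h' where "h' \<in> I'" and h': "weighted_ord_ideal l w I' = weighted_ord l w h'"
    using weighted_ord_ideal_attained[OF \<open>I' \<noteq> {}\<close>, of l w] by blast
  have g0: "mcoeff g 0 = 0"
    using \<open>elem_ord g \<ge> 1\<close> by (rule elem_ord_ge_1_imp)

  \<comment> \<open>an infinite value could not be exceeded, so \<open>m\<close> is the weight of a monomial\<close>
  have "h \<noteq> 0"
  proof
    assume "h = 0"
    then have "m = replicate l \<infinity>" by (simp add: h(2) weighted_ord_def)
    with less h' not_replicate_infinity_less[of "weighted_ord l w h'" l] show False by simp
  qed
  then obtain \<mu> where \<mu>: "m = monom_weight l w \<mu>" "mcoeff h \<mu> \<noteq> 0"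
    using weighted_ord_attained[of h l w] h(2) by auto
  define V where "V = (poly_weight l w :: ('n \<Rightarrow>\<^sub>0 nat) \<Rightarrow> real poly)"
  interpret monomial_weight V
    unfolding V_def by (rule poly_weight.monomial_weight_axioms)
  have "monom_weight l w 0 < monom_weight l w \<mu>"
    using assms(5) \<mu>(1)
    by (simp add: m_def I_def monom_weight_eq weight_entry_def map_replicate_const zero_enat_def)
  then have "0 < V \<mu>"
    using weight_0 by (simp add: V_def flip: poly_weight_less_iff)
  have "length m = l" by (simp add: h(2))
  then have "l > 0"
    using assms(5) by (cases l) (auto simp: m_def I_def)
  define t where "t = smult (1 / fact c) (V \<mu>)"
  have multiple: "of_nat n * t = smult (real n / fact c) (V \<mu>)" for n
    by (simp add: t_def of_nat_poly)
  have "0 < t"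
    using \<open>0 < V \<mu>\<close> by (simp add: t_def less_poly_def pos_poly_def)

  \<comment> \<open>the powers in the coefficient ideals translate the bound \<open>m\<close> into the bounds \<open>(c - i) t\<close>\<close>
  define e where "e i = fact c div (c - i)" for i
  have e: "e i > 0" "of_nat (e i) * (of_nat (c - i) * t) = V \<mu>" if "i < c" for i
  proof -
    have "c - i dvd fact c" using that by (intro dvd_fact) auto
    then have "e i * (c - i) = fact c" by (simp add: e_def)
    then show "e i > 0" by (cases "e i") auto
    have "of_nat (e i) * (of_nat (c - i) * t) = of_nat (e i * (c - i)) * t"
      by (simp add: mult.assoc)
    also have "\<dots> = V \<mu>"
      unfolding \<open>e i * (c - i) = fact c\<close> multiple by simp
    finally show "of_nat (e i) * (of_nat (c - i) * t) = V \<mu>" .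
  qed
  have before: "fps_nth k i \<in> weight_ge V (of_nat (c - i) * t)" if "k \<in> J" "i < c" for k i
  proof (rule weight_ge_if_power)
    have "fps_nth k i ^ e i \<in> I"
      unfolding I_def coeff_ideal_def e_def
      by (rule subsetD[OF ideal_gen_superset]) (use that expands_in_fps_X_iff in blast)
    then have "m \<le> weighted_ord l w (fps_nth k i ^ e i)"
      unfolding m_def by (rule weighted_ord_ideal_le)
    then show "fps_nth k i ^ e i \<in> weight_ge V (of_nat (e i) * (of_nat (c - i) * t))"
      using weight_ge_if_weighted_ord e(2)[OF that(2)] by (simp add: \<mu>(1) V_def)
  qed (use e that in auto)
  have after: "a i \<in> weight_gt V (of_nat (c - i) * t)"
    if "k \<in> J" "expands_in (fps_X - fps_const g) k a" "i < c" for k a i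
  proof -
    have "a i ^ e i \<in> I'"
      unfolding I'_def coeff_ideal_def e_def
      by (rule subsetD[OF ideal_gen_superset]) (use that in blast)
    then have "m < weighted_ord l w (a i ^ e i)"
      using less weighted_ord_ideal_le[of "a i ^ e i" I' l w] by simp
    then have "a i ^ e i \<in> weight_gt V (of_nat (e i) * (of_nat (c - i) * t))"
      using weight_gt_if_weighted_ord e(2)[OF that(3)] by (simp add: \<mu>(1) V_def)
    then show ?thesis
      using weight_gt_power_iff e(1)[OF that(3)] by blast
  qed

  have "z_regular c f"
    using assms(8) by (simp add: omega_clean_def Let_def)
  then have unit: "mcoeff (fps_nth f c) 0 \<noteq> 0"
    by (rule z_regular_unit_coefficient)
  have g_ge: "g \<in> weight_ge V t"
  proof -
    obtain a H where a: "expands_in (fps_X - fps_const g) f a"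
      "\<And>N. f = (\<Sum>i<N. fps_const (a i) * (fps_X - fps_const g) ^ i) + (fps_X - fps_const g) ^ N * H N"
      using expansion_in_shifted_variable[OF g0] by blast
    show ?thesis
      by (rule weight_of_shift_ge[OF a(2) after[OF \<open>f \<in> J\<close> a(1)] _ \<open>c > 0\<close> unit g0])
        (use before[OF \<open>f \<in> J\<close>, of 0] \<open>c > 0\<close> in auto)
  qed
  have higher: "fps_nth k i - of_nat (c choose i) * (- g) ^ (c - i) * fps_nth k c \<in> weight_gt V (of_nat (c - i) * t)"
    if "k \<in> J" "i \<le> c" for k i
  proof -
    obtain a H where a: "expands_in (fps_X - fps_const g) k a"
      "\<And>N. k = (\<Sum>i<N. fps_const (a i) * (fps_X - fps_const g) ^ i) + (fps_X - fps_const g) ^ N * H N"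
      using expansion_in_shifted_variable[OF g0] by blast
    show ?thesis
      by (rule coefficient_mod_higher_weight[OF a(2) after[OF \<open>k \<in> J\<close> a(1)] \<open>0 < t\<close> g_ge that(2)])
  qed

  \<comment> \<open>otherwise the whole coefficient ideal, and with it \<open>h\<close>, would have value greater than \<open>m\<close>\<close>
  have g_not_gt: "g \<notin> weight_gt V t"
  proof
    assume g: "g \<in> weight_gt V t"
    have "fps_nth k i \<in> weight_gt V (of_nat (c - i) * t)" if "k \<in> J" "i < c" for k i
    proof -
      have "- g \<in> weight_gt V t"
        using g by (simp add: weight_gt_def)
      then have "(- g) ^ (c - i) * (of_nat (c choose i) * fps_nth k c) \<in> weight_gt V (of_nat (c - i) * t)"
        using that by (intro weight_gt_mult_right weight_gt_power) auto
      from weight_gt_add[OF this higher[of k i]] that show ?thesis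
        by (simp add: ac_simps)
    qed
    then have "fps_nth k i ^ e i \<in> weight_gt V (V \<mu>)" if "k \<in> J" "i < c" for k i
      using weight_gt_power[of "fps_nth k i" "of_nat (c - i) * t" "e i"] e[of i] that by simp
    then have "I \<subseteq> weight_gt V (V \<mu>)"
      unfolding I_def coeff_ideal_def
      by (intro ideal_gen_least is_ideal_weight_gt) (auto simp: expands_in_fps_X_iff e_def)
    then show False
      using h(1) \<mu>(2) by (auto simp: weight_gt_def)
  qed

  note binomial = char_part_binomial[OF \<open>c > 0\<close>, where 'k = 'k, folded q_def]
  have cq: "c - (c - q) = q" using binomial(2) by simp
  obtain G where G: "fps_nth f (c - q) \<in> weight_ge V (of_nat q * t)"
    "fps_nth f (c - q) \<notin> weight_gt V (of_nat q * t)"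
    "weight_part V (of_nat q * t) (fps_nth f (c - q)) = weight_part V 0 (fps_nth f c) * G ^ q"
  proof (rule initial_part_pure_power[OF _ binomial(3,1) g_ge g_not_gt unit])
    show "fps_nth f (c - q) - of_nat (c choose (c - q)) * (- g) ^ q * fps_nth f c \<in> weight_gt V (of_nat q * t)"
      using higher[OF \<open>f \<in> J\<close>, of "c - q"] by (simp add: cq)
  qed
  from assms(8) consider
      i where "c - q < i" "i < c" "ext_vec (weighted_ord l w (fps_nth f i)) = scale_vec (real (c - i) / fact c) m"
    | "ext_vec (weighted_ord l w (fps_nth f (c - q))) > scale_vec (real q / fact c) m"
    | "\<nexists>G. initial_form l w (fps_nth f (c - q)) = initial_form l w (fps_nth f c) * G ^ q"
    unfolding omega_clean_def Let_def m_def I_def q_def by blast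
  then show False
  proof cases
    case 1
    have "(of_nat (c choose i) :: ('k, 'n) mpowser) = 0"
      using binomial(4)[OF 1(1,2)] by (simp add: of_nat_eq_const_mpowser mpowser_eq_iff)
    then have gt: "fps_nth f i \<in> weight_gt V (of_nat (c - i) * t)"
      using higher[OF \<open>f \<in> J\<close>, of i] 1(2) by simp
    \<comment> \<open>the value of \<open>0\<close> is infinite, whereas \<open>m\<close> is finite and has at least one entry\<close>
    have "fps_nth f i \<noteq> 0"
    proof
      assume "fps_nth f i = 0"
      with 1(3) show False
        using \<open>l > 0\<close> by (cases l) (auto simp: \<mu>(1) weighted_ord_def ext_vec_def scale_vec_def monom_weight_eq
            upt_conv_Cons simp del: upt_Suc)
    qed
    then obtain \<alpha> where "mcoeff (fps_nth f i) \<alpha> \<noteq> 0" "weighted_ord l w (fps_nth f i) = monom_weight l w \<alpha>"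
      using weighted_ord_attained by blast
    with 1(3) gt show False
      by (auto simp: \<mu>(1) ext_vec_eq_scale_vec_iff weight_gt_def multiple V_def)
  next
    case 2
    obtain \<alpha> where "V \<alpha> = of_nat q * t" "weighted_ord l w (fps_nth f (c - q)) = monom_weight l w \<alpha>"
      using weighted_ord_eq[OF G(1,2)[unfolded V_def]] unfolding V_def by blast
    then have "ext_vec (weighted_ord l w (fps_nth f (c - q))) = scale_vec (real q / fact c) m"
      by (simp add: \<mu>(1) ext_vec_eq_scale_vec_iff multiple V_def)
    with 2 show False by simp
  next
    case 3
    have "initial_form l w (fps_nth f (c - q)) = weight_part V (of_nat q * t) (fps_nth f (c - q))"
      unfolding V_def by (rule initial_form_eq) (use G in \<open>simp_all add: V_def\<close>)
    moreover have "initial_form l w (fps_nth f c) = weight_part V 0 (fps_nth f c)"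
      unfolding V_def by (rule initial_form_eq) (use weight_unit[OF unit] in \<open>simp_all add: V_def\<close>)
    ultimately show False
      using 3 G(3) by auto
  qed
qed

end
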